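(* For the Poisson-exponential family (with fixed $\kappa>0$), prediction based on conditional normalized maximum likelihood (CNML) equals Bayesian prediction based on Jeffreys' prior, and Jeffreys' posterior equals an inverse Gaussian distribution.
   Context: Poisson-exponential family: for $\beta>0$, $P_\beta$ is the distribution of $Y=\sum_{i=1}^N X_i$, where $N$ is Poisson distributed with mean $\kappa/(2\beta)$ and $X_1,X_2,\dots$ are iid exponential with rate $\beta$, independent of $N$. It has a point mass at $0$ of weight $\exp(-\kappa/(2\beta))$ and, for $x>0$, density $\sum_{\alpha=1}^\infty\frac{(\kappa/2)^\alpha x^{\alpha-1}}{\alpha!\,\Gamma(\alpha)}\exp\left(-\beta x-\frac{\kappa}{2\beta}\right)$. It is a natural exponential family with natural parameter $-\beta$ and cumulant generating function $\kappa/(2\beta)$. Let $\lambda$ denote the dominating measure on $[0,\infty)$ consisting of a unit point mass at $0$ and the density $\sum_{\alpha=1}^\infty\frac{(\kappa/2)^\alpha x^{\alpha-1}}{\alpha!\,\Gamma(\alpha)}$ on $(0,\infty)$, so that $p_\beta(x)=\frac{\mathrm dP_\beta}{\mathrm d\lambda}(x)=\exp(-\beta x-\frac{\kappa}{2\beta})$. For sequences, $p_\beta(x^n)=\prod_{i=1}^n p_\beta(x_i)$ and $x_{m+1}^n=x_{m+1}\cdots x_n$. Let $\hat\beta(x^n)$ be the maximum likelihood estimate of $\beta$, i.e. the value of $\beta$ for which $P_\beta$ has mean value equal to the average of $x^n$. The CNML predictor is $$p^n_{cnml}(x_{m+1}^n\mid x^m)=\frac{p_{\hat\beta(x^n)}(x^n)}{\int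 p_{\hat\beta(x^my^{n-m})}(x^my^{n-m})\,\mathrm d\lambda^{n-m}(y^{n-m})}.$$ The Bayesian predictor with (possibly non-normalizable) prior density $\pi$ is $p_\pi(x_{m+1}^n\mid x^m)=\int_0^\infty p_\beta(x^n)\pi(\beta)\,\mathrm d\beta\big/\int_0^\infty p_\beta(x^m)\pi(\beta)\,\mathrm d\beta$. Equality of the two predictions is understood where both are defined. Jeffreys' prior for this family is proportional to $\kappa^{1/2}\beta^{-3/2}$ on $(0,\infty)$, which cannot be normalized, and Jeffreys' posterior of $\beta$ given $x^m$ has density proportional to $p_\beta(x^m)\beta^{-3/2}$. The inverse Gaussian distribution with mean $\beta_0$ and shape parameter $k$ has density $\left(\frac{k}{2\pi\beta^3}\right)^{1/2}\exp\left(-k\frac{(\beta-\beta_0)^2}{2\beta_0^2\beta}\right)$ for $\beta>0$.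
   Formalization: The claim that Jeffreys' posterior is inverse Gaussian is stated only for x^m with at least one nonzero observation; for an all-zero x^m the posterior is a Lévy law with infinite mean (improper if m = 0), so the unrestricted claim fails. *)

theory Defs
  imports "HOL-Probability.Probability"
begin

section \<open>The Poisson-exponential family\<close>

definition poisson_exponential :: "real \<Rightarrow> real \<Rightarrow> real measure" where
  "poisson_exponential \<kappa> \<beta> =
     distr (measure_pmf (poisson_pmf (\<kappa> / (2 * \<beta>))) \<Otimes>\<^sub>M
            (\<Pi>\<^sub>M i\<in>(UNIV :: nat set). density lborel (exponential_density \<beta>)))
       borel (\<lambda>(N, X). \<Sum>i<N. X i)"

text \<open>The series index \<open>a\<close> below is \<open>\<alpha> - 1\<close> in the usual
  \<open>\<Sum>\<alpha>\<ge>1. (\<kappa>/2)^\<alpha> * x^(\<alpha>-1) / (\<alpha>! * \<Gamma>(\<alpha>))\<close>.\<close>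

definition pe_series :: "real \<Rightarrow> real \<Rightarrow> real" where
  "pe_series \<kappa> x =
     (\<Sum>a. (\<kappa> / 2) ^ Suc a * x ^ a / (fact (Suc a) * Gamma (real (Suc a))))"

definition pe_base :: "real \<Rightarrow> real measure" where
  "pe_base \<kappa> = measure_of UNIV (sets borel)
     (\<lambda>A. indicator A 0 + (\<integral>\<^sup>+ x \<in> A \<inter> {0<..}. ennreal (pe_series \<kappa> x) \<partial>lborel))"

definition pe_density :: "real \<Rightarrow> real \<Rightarrow> real \<Rightarrow> real" where
  "pe_density \<kappa> \<beta> x = exp (- \<beta> * x - \<kappa> / (2 * \<beta>))"

text \<open>A sample \<open>x\<^sup>n = x\<^sub>1 \<dots> x\<^sub>n\<close> is a function \<open>x :: nat \<Rightarrow> real\<close> of which only the values at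
  \<open>1, \<dots>, n\<close> matter.\<close>

definition pe_lik :: "real \<Rightarrow> real \<Rightarrow> nat \<Rightarrow> (nat \<Rightarrow> real) \<Rightarrow> real" where
  "pe_lik \<kappa> \<beta> n x = (\<Prod>i\<in>{1..n}. pe_density \<kappa> \<beta> (x i))"


section \<open>Conditional normalized maximum likelihood\<close>

definition is_pe_mle :: "real \<Rightarrow> nat \<Rightarrow> (nat \<Rightarrow> real) \<Rightarrow> real \<Rightarrow> bool" where
  "is_pe_mle \<kappa> n x \<beta> \<longleftrightarrow> 0 < \<beta> \<and>
     has_bochner_integral (poisson_exponential \<kappa> \<beta>) (\<lambda>y. y) ((\<Sum>i\<in>{1..n}. x i) / real n)"

definition pe_mle :: "real \<Rightarrow> nat \<Rightarrow> (nat \<Rightarrow> real) \<Rightarrow> real" where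
  "pe_mle \<kappa> n x = (THE \<beta>. is_pe_mle \<kappa> n x \<beta>)"

text \<open>\<open>append_sample m x y\<close> is the concatenation of \<open>x\<^sub>1 \<dots> x\<^sub>m\<close> and \<open>y\<^sub>m\<^sub>+\<^sub>1 y\<^sub>m\<^sub>+\<^sub>2 \<dots>\<close>:
  the continuation keeps its original indices.\<close>

definition append_sample :: "nat \<Rightarrow> (nat \<Rightarrow> real) \<Rightarrow> (nat \<Rightarrow> real) \<Rightarrow> nat \<Rightarrow> real" where
  "append_sample m x y i = (if i \<le> m then x i else y i)"

definition pe_ml :: "real \<Rightarrow> nat \<Rightarrow> (nat \<Rightarrow> real) \<Rightarrow> real" where
  "pe_ml \<kappa> n x = pe_lik \<kappa> (pe_mle \<kappa> n x) n x"

definition cnml :: "real \<Rightarrow> nat \<Rightarrow> nat \<Rightarrow> (nat \<Rightarrow> real) \<Rightarrow> real" where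
  "cnml \<kappa> m n x =
     pe_ml \<kappa> n x / (\<integral> y. pe_ml \<kappa> n (append_sample m x y) \<partial>(\<Pi>\<^sub>M i\<in>{m+1..n}. pe_base \<kappa>))"

text \<open>No maximum likelihood estimate exists for a sample of zeros; since \<open>pe_base\<close> has an atom at
  0, the almost-everywhere condition fails when \<open>x\<^sub>1 = \<dots> = x\<^sub>m = 0\<close>.\<close>

definition cnml_defined :: "real \<Rightarrow> nat \<Rightarrow> nat \<Rightarrow> (nat \<Rightarrow> real) \<Rightarrow> bool" where
  "cnml_defined \<kappa> m n x \<longleftrightarrow>
     (\<exists>!\<beta>. is_pe_mle \<kappa> n x \<beta>) \<and>
     (AE y in (\<Pi>\<^sub>M i\<in>{m+1..n}. pe_base \<kappa>). \<exists>!\<beta>. is_pe_mle \<kappa> n (append_sample m x y) \<beta>) \<and>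
     integrable (\<Pi>\<^sub>M i\<in>{m+1..n}. pe_base \<kappa>) (\<lambda>y. pe_ml \<kappa> n (append_sample m x y)) \<and>
     (\<integral> y. pe_ml \<kappa> n (append_sample m x y) \<partial>(\<Pi>\<^sub>M i\<in>{m+1..n}. pe_base \<kappa>)) \<noteq> 0"


section \<open>Bayesian prediction and Jeffreys' prior\<close>

definition pe_marginal :: "real \<Rightarrow> (real \<Rightarrow> real) \<Rightarrow> nat \<Rightarrow> (nat \<Rightarrow> real) \<Rightarrow> real" where
  "pe_marginal \<kappa> prior n x = (LBINT \<beta>:{0<..}. pe_lik \<kappa> \<beta> n x * prior \<beta>)"

definition bayes :: "real \<Rightarrow> (real \<Rightarrow> real) \<Rightarrow> nat \<Rightarrow> nat \<Rightarrow> (nat \<Rightarrow> real) \<Rightarrow> real" where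
  "bayes \<kappa> prior m n x = pe_marginal \<kappa> prior n x / pe_marginal \<kappa> prior m x"

definition bayes_defined :: "real \<Rightarrow> (real \<Rightarrow> real) \<Rightarrow> nat \<Rightarrow> nat \<Rightarrow> (nat \<Rightarrow> real) \<Rightarrow> bool" where
  "bayes_defined \<kappa> prior m n x \<longleftrightarrow>
     set_integrable lborel {0<..} (\<lambda>\<beta>. pe_lik \<kappa> \<beta> n x * prior \<beta>) \<and>
     set_integrable lborel {0<..} (\<lambda>\<beta>. pe_lik \<kappa> \<beta> m x * prior \<beta>) \<and>
     pe_marginal \<kappa> prior m x \<noteq> 0"

definition pe_posterior ::
    "real \<Rightarrow> (real \<Rightarrow> real) \<Rightarrow> nat \<Rightarrow> (nat \<Rightarrow> real) \<Rightarrow> real measure" where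
  "pe_posterior \<kappa> prior m x = density lborel
     (\<lambda>\<beta>. ennreal (indicator {0<..} \<beta> * (pe_lik \<kappa> \<beta> m x * prior \<beta> / pe_marginal \<kappa> prior m x)))"

definition pe_fisher_information :: "real \<Rightarrow> real \<Rightarrow> real" where
  "pe_fisher_information \<kappa> \<beta> =
     (\<integral> x. (deriv (\<lambda>b. ln (pe_density \<kappa> b x)) \<beta>)\<^sup>2 \<partial>(poisson_exponential \<kappa> \<beta>))"

text \<open>For this family the Fisher information is \<open>\<kappa> / \<beta>^3\<close>, so the prior below is
  \<open>\<kappa>^(1/2) * \<beta>^(-3/2)\<close>.\<close>

definition jeffreys_prior :: "real \<Rightarrow> real \<Rightarrow> real" where
  "jeffreys_prior \<kappa> \<beta> = sqrt (pe_fisher_information \<kappa> \<beta>)"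

definition inverse_gaussian :: "real \<Rightarrow> real \<Rightarrow> real measure" where
  "inverse_gaussian \<beta>\<^sub>0 k = density lborel
     (\<lambda>\<beta>. ennreal (indicator {0<..} \<beta> *
        (sqrt (k / (2 * pi * \<beta> ^ 3)) * exp (- k * (\<beta> - \<beta>\<^sub>0)\<^sup>2 / (2 * \<beta>\<^sub>0\<^sup>2 * \<beta>)))))"


section \<open>The density of the family\<close>

lemma sets_pe_base [simp, measurable_cong]: "sets (pe_base \<kappa>) = sets borel"
  unfolding pe_base_def using sets.sigma_sets_eq[of borel] by (simp add: sets_measure_of_conv)

lemma space_pe_base [simp]: "space (pe_base \<kappa>) = UNIV"
  unfolding pe_base_def by (simp add: space_measure_of_conv)

lemma borel_measurable_pe_series [measurable]: "pe_series \<kappa> \<in> borel_measurable borel"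
  unfolding pe_series_def[abs_def] by measurable

lemma emeasure_pe_base:
  assumes "A \<in> sets borel"
  shows "emeasure (pe_base \<kappa>) A =
    indicator A 0 + (\<integral>\<^sup>+ x \<in> A \<inter> {0<..}. ennreal (pe_series \<kappa> x) \<partial>lborel)"
proof -
  let ?D = "density lborel (\<lambda>x. ennreal (pe_series \<kappa> x) * indicator {0<..} x)"
  let ?\<mu> = "\<lambda>A. indicator A 0 + (\<integral>\<^sup>+ x \<in> A \<inter> {0<..}. ennreal (pe_series \<kappa> x) \<partial>lborel)"
  have eq: "?\<mu> A = emeasure (return borel 0) A + emeasure ?D A" if "A \<in> sets borel" for A
    using that
    by (auto simp: emeasure_density intro!: nn_integral_cong split: split_indicator)
  have sa: "sigma_algebra UNIV (sets (borel :: real measure))"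
    using sets.sigma_algebra_axioms[of "borel :: real measure"] by simp
  have ca: "countably_additive (sets (borel :: real measure)) ?\<mu>"
    unfolding countably_additive_def
  proof (intro allI impI)
    fix F :: "nat \<Rightarrow> real set"
    assume F: "range F \<subseteq> sets borel" "disjoint_family F" "(\<Union>i. F i) \<in> sets borel"
    have "(\<Sum>i. ?\<mu> (F i)) = (\<Sum>i. emeasure (return borel 0) (F i) + emeasure ?D (F i))"
      using F(1) by (intro suminf_cong eq) auto
    also have "\<dots> = (\<Sum>i. emeasure (return borel 0) (F i)) + (\<Sum>i. emeasure ?D (F i))"
      by (rule suminf_add[symmetric]) auto
    also have "\<dots> = emeasure (return borel 0) (\<Union>i. F i) + emeasure ?D (\<Union>i. F i)"
      using F by (subst (1 2) suminf_emeasure) auto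
    also have "\<dots> = ?\<mu> (\<Union>i. F i)"
      using F(3) by (rule eq[symmetric])
    finally show "(\<Sum>i. ?\<mu> (F i)) = ?\<mu> (\<Union>i. F i)" .
  qed
  have pos: "positive (sets (borel :: real measure)) ?\<mu>"
    by (simp add: positive_def)
  show ?thesis
    using emeasure_measure_of_sigma[OF sa pos ca assms] by (simp add: pe_base_def)
qed

lemma nn_integral_pe_base:
  assumes "f \<in> borel_measurable borel"
  shows "(\<integral>\<^sup>+ x. f x \<partial>pe_base \<kappa>) =
    f 0 + (\<integral>\<^sup>+ x \<in> {0<..}. f x * ennreal (pe_series \<kappa> x) \<partial>lborel)"
  using assms
proof (induction rule: borel_measurable_induct)
  case (cong f g)
  then show ?case by simp
next
  case (set A)
  then show ?case
    by (auto simp: emeasure_pe_base intro!: nn_integral_cong split: split_indicator)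
next
  case (mult u c)
  then have [measurable]: "u \<in> borel_measurable borel" by simp
  have "u \<in> borel_measurable (pe_base \<kappa>)" by measurable
  then show ?case
    using mult by (simp add: nn_integral_cmult distrib_left mult.assoc)
next
  case (add u v)
  then have [measurable]: "u \<in> borel_measurable borel" "v \<in> borel_measurable borel" by simp_all
  have "u \<in> borel_measurable (pe_base \<kappa>)" "v \<in> borel_measurable (pe_base \<kappa>)" by measurable
  then show ?case
    using add by (simp add: nn_integral_add distrib_right add_ac)
next
  case (seq U)
  note incU = \<open>incseq U\<close>
  have IH: "(\<integral>\<^sup>+ x. U i x \<partial>pe_base \<kappa>) =
      U i 0 + (\<integral>\<^sup>+ x \<in> {0<..}. U i x * ennreal (pe_series \<kappa> x) \<partial>lborel)" for i
    using seq by blast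
  have [measurable]: "\<And>i. U i \<in> borel_measurable borel" using seq by blast
  have m: "U i \<in> borel_measurable (pe_base \<kappa>)" for i by measurable
  have inc: "incseq (\<lambda>i. U i x)" for x
    using incU by (auto simp: incseq_def le_fun_def)
  let ?h = "\<lambda>x. ennreal (pe_series \<kappa> x) * indicator {0<..} x"
  have "(\<integral>\<^sup>+ x. (SUP i. U i x) \<partial>pe_base \<kappa>) = (SUP i. \<integral>\<^sup>+ x. U i x \<partial>pe_base \<kappa>)"
    using m incU by (intro nn_integral_monotone_convergence_SUP)
  also have "\<dots> = (SUP i. U i 0 + (\<integral>\<^sup>+ x. U i x * ?h x \<partial>lborel))"
    by (simp add: IH mult.assoc)
  also have "\<dots> = (SUP i. U i 0) + (SUP i. \<integral>\<^sup>+ x. U i x * ?h x \<partial>lborel)"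
    using incU
    by (intro ennreal_SUP_add inc)
       (auto simp: incseq_def le_fun_def intro!: nn_integral_mono mult_right_mono)
  also have "(SUP i. \<integral>\<^sup>+ x. U i x * ?h x \<partial>lborel) = (\<integral>\<^sup>+ x. (SUP i. U i x * ?h x) \<partial>lborel)"
    using incU
    by (intro nn_integral_monotone_convergence_SUP[symmetric])
       (auto simp: incseq_def le_fun_def intro!: mult_right_mono)
  also have "\<dots> = (\<integral>\<^sup>+ x. (SUP i. U i x) * ?h x \<partial>lborel)"
    by (simp add: SUP_mult_right_ennreal)
  finally show ?case by (simp add: mult.assoc image_comp)
qed

lemma poisson_exponential_eq_density:
  assumes "0 < \<kappa>" and "0 < \<beta>"
  shows "poisson_exponential \<kappa> \<beta> = density (pe_base \<kappa>) (\<lambda>x. ennreal (pe_density \<kappa> \<beta> x))"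
proof (rule measure_eqI)
  show "sets (poisson_exponential \<kappa> \<beta>) = sets (density (pe_base \<kappa>) (\<lambda>x. ennreal (pe_density \<kappa> \<beta> x)))"
    by (simp add: poisson_exponential_def)
next
  fix A assume "A \<in> sets (poisson_exponential \<kappa> \<beta>)"
  then have A [measurable]: "A \<in> sets borel"
    by (simp add: poisson_exponential_def)
  define r where "r = \<kappa> / (2 * \<beta>)"
  have r: "0 < r" using assms by (simp add: r_def)
  define E where "E = density lborel (\<lambda>x. ennreal (exponential_density \<beta> x))"
  define P where "P = PiM (UNIV :: nat set) (\<lambda>_. E)"
  have E: "prob_space E"
    unfolding E_def using assms(2) by (rule prob_space_erlang_density)
  have setsE [measurable_cong, simp]: "sets E = sets borel" by (simp add: E_def)
  interpret PP: product_prob_space "\<lambda>_. E" "UNIV :: nat set"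
    using E by (auto simp: product_prob_space_def product_sigma_finite_def
      product_prob_space_axioms_def prob_space_imp_sigma_finite)
  interpret P: prob_space P
    unfolding P_def by (rule PP.prob_space_axioms)
  have rv: "(\<lambda>X. X i) \<in> borel_measurable P" for i
    unfolding P_def by measurable
  have comp: "distr P borel (\<lambda>X. X i) = E" for i
    using PP.PiM_component[of i] distr_cong[of P P borel E "\<lambda>X. X i" "\<lambda>X. X i"]
    by (simp add: P_def)
  have X: "distributed P lborel (\<lambda>X. X i) (exponential_density \<beta>)" for i
    using comp[of i] rv[of i] assms(2)
    by (auto simp: distributed_def E_def cong: distr_cong)
  have ind: "P.indep_vars (\<lambda>i. borel) (\<lambda>i X. X i) {..<Suc k}" for k :: nat
  proof -
    have "distr P (\<Pi>\<^sub>M i\<in>{..<Suc k}. borel) (\<lambda>x. \<lambda>i\<in>{..<Suc k}. x i) =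
      distr (PiM UNIV (\<lambda>_. E)) (PiM {..<Suc k} (\<lambda>_. E)) (\<lambda>x. restrict x {..<Suc k})"
      unfolding P_def by (intro distr_cong) (auto intro!: sets_PiM_cong)
    also have "\<dots> = PiM {..<Suc k} (\<lambda>_. E)"
      by (rule PP.distr_PiM_restrict_finite) auto
    finally show ?thesis
      using rv comp by (subst P.indep_vars_iff_distr_eq_PiM') auto
  qed
  have dist: "distributed P lborel (\<lambda>X. \<Sum>i<Suc k. X i) (erlang_density k \<beta>)" for k :: nat
    using P.exponential_distributed_sum[OF _ _ assms(2) X ind, of k]
    by (simp del: sum.lessThan_Suc add: lessThan_empty_iff)
  have prob: "emeasure P {X \<in> space P. (\<Sum>i<Suc k. X i) \<in> A} =
      (\<integral>\<^sup>+ x. ennreal (erlang_density k \<beta> x) * indicator A x \<partial>lborel)" for k :: nat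
    using distributed_emeasure[OF dist[of k], of A] by (simp add: vimage_def Int_def conj_commute)
  have meas: "(\<lambda>(N, X). \<Sum>i<N. X i) \<in> borel_measurable (measure_pmf (poisson_pmf r) \<Otimes>\<^sub>M P)"
  proof -
    have "(\<lambda>(N :: nat, X). \<Sum>i<N. X i) \<in> borel_measurable (count_space UNIV \<Otimes>\<^sub>M P)"
      by (rule measurable_pair_measure_countable1) (use rv in \<open>auto\<close>)
    also have "borel_measurable (count_space UNIV \<Otimes>\<^sub>M P) =
        borel_measurable (measure_pmf (poisson_pmf r) \<Otimes>\<^sub>M P)"
      by (intro measurable_cong_sets sets_pair_measure_cong) auto
    finally show ?thesis .
  qed
  have "emeasure (poisson_exponential \<kappa> \<beta>) A =
    emeasure (measure_pmf (poisson_pmf r) \<Otimes>\<^sub>M P)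
      ((\<lambda>(N, X). \<Sum>i<N. X i) -` A \<inter> space (measure_pmf (poisson_pmf r) \<Otimes>\<^sub>M P))"
    using meas A
    unfolding poisson_exponential_def P_def E_def r_def by (rule emeasure_distr)
  also have "\<dots> = (\<integral>\<^sup>+ N. emeasure P {X \<in> space P. (\<Sum>i<N. X i) \<in> A} \<partial>measure_pmf (poisson_pmf r))"
    using measurable_sets[OF meas A]
    by (subst P.emeasure_pair_measure_alt)
       (auto intro!: nn_integral_cong arg_cong[where f = "emeasure P"] simp: space_pair_measure)
  also have "\<dots> = (\<Sum>N. ennreal (pmf (poisson_pmf r) N) * emeasure P {X \<in> space P. (\<Sum>i<N. X i) \<in> A})"
    by (simp only: nn_integral_measure_pmf nn_integral_count_space_nat)
  also have "\<dots> = ennreal (pmf (poisson_pmf r) 0) * emeasure P {X \<in> space P. (\<Sum>i<0. X i) \<in> A} +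
      (\<Sum>k. ennreal (pmf (poisson_pmf r) (Suc k)) * emeasure P {X \<in> space P. (\<Sum>i<Suc k. X i) \<in> A})"
    by (subst suminf_offset[where i = "Suc 0"]) (simp_all add: add.commute del: sum.lessThan_Suc pmf_poisson add: lessThan_Suc)
  also have "ennreal (pmf (poisson_pmf r) 0) * emeasure P {X \<in> space P. (\<Sum>i<0. X i) \<in> A} =
      ennreal (pe_density \<kappa> \<beta> 0) * indicator A 0"
    using r by (simp add: pe_density_def r_def P.emeasure_space_1 split: split_indicator)
  also have "(\<Sum>k. ennreal (pmf (poisson_pmf r) (Suc k)) *
        emeasure P {X \<in> space P. (\<Sum>i<Suc k. X i) \<in> A}) =
      (\<integral>\<^sup>+ x \<in> {0<..}. (ennreal (pe_density \<kappa> \<beta> x) * indicator A x) *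
        ennreal (pe_series \<kappa> x) \<partial>lborel)"
  proof -
    let ?t = "\<lambda>k x. (\<kappa> / 2) ^ Suc k * x ^ k / (fact (Suc k) * Gamma (real (Suc k)))"
    have term_eq: "pmf (poisson_pmf r) (Suc k) * erlang_density k \<beta> x = pe_density \<kappa> \<beta> x * ?t k x"
      if "0 < x" for k x
    proof -
      have G: "Gamma (real (Suc k)) = fact k"
        using Gamma_fact[of k, where 'a = real] by (simp add: add.commute)
      have "\<kappa> / 2 = r * \<beta>" using assms by (simp add: r_def)
      then have pow: "(\<kappa> / 2) ^ Suc k = r ^ Suc k * \<beta> ^ Suc k"
        by (simp only: power_mult_distrib)
      have "pe_density \<kappa> \<beta> x = exp (- r) * exp (- \<beta> * x)"
        by (simp add: pe_density_def r_def exp_add[symmetric])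
      then show ?thesis
        unfolding G pow pmf_poisson[OF r] using that
        by (simp add: erlang_density_def del: fact_Suc power_Suc)
    qed
    have summable_t: "summable (\<lambda>k. ?t k x)" if x: "0 < x" for x
    proof (rule summable_comparison_test')
      show "summable (\<lambda>k. (\<kappa> / 2) * ((\<kappa> / 2 * x) ^ k / fact k))"
        using summable_exp[of "\<kappa> / 2 * x"]
        by (intro summable_mult[of "\<lambda>k. (\<kappa> / 2 * x) ^ k / fact k"])
           (simp only: divide_inverse mult.commute[of "inverse (fact _)"])
      fix k :: nat
      have G: "Gamma (real (Suc k)) = fact k" using Gamma_fact[of k, where 'a = real] by (simp add: add.commute)
      have "fact k * 1 \<le> (fact (Suc k) * fact k :: real)"
        by (subst mult.commute) (intro mult_right_mono fact_ge_1, simp)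
      then have "(\<kappa> / 2) ^ Suc k * x ^ k / (fact (Suc k) * fact k) \<le> (\<kappa> / 2) ^ Suc k * x ^ k / fact k"
        using x assms by (intro divide_left_mono) auto
      then show "norm (?t k x) \<le> (\<kappa> / 2) * ((\<kappa> / 2 * x) ^ k / fact k)"
        using x assms unfolding G power_mult_distrib[of "\<kappa> / 2" x k]
        by (simp add: mult_ac del: fact_Suc)
    qed
    have t_nn: "0 \<le> ?t k x" if "0 < x" for k x
      using that assms by (intro divide_nonneg_nonneg mult_nonneg_nonneg Gamma_real_nonneg) auto
    have "(\<Sum>k. ennreal (pmf (poisson_pmf r) (Suc k)) *
          emeasure P {X \<in> space P. (\<Sum>i<Suc k. X i) \<in> A}) =
        (\<Sum>k. \<integral>\<^sup>+ x. ennreal (pmf (poisson_pmf r) (Suc k)) *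
          (ennreal (erlang_density k \<beta> x) * indicator A x) \<partial>lborel)"
      unfolding prob by (subst nn_integral_cmult) auto
    also have "\<dots> = (\<integral>\<^sup>+ x. (\<Sum>k. ennreal (pmf (poisson_pmf r) (Suc k)) *
          (ennreal (erlang_density k \<beta> x) * indicator A x)) \<partial>lborel)"
      by (rule nn_integral_suminf[symmetric]) measurable
    also have "\<dots> = (\<integral>\<^sup>+ x \<in> {0<..}. (ennreal (pe_density \<kappa> \<beta> x) * indicator A x) *
        ennreal (pe_series \<kappa> x) \<partial>lborel)"
    proof (rule nn_integral_cong_AE)
      have "AE x in lborel. x \<noteq> (0 :: real)" by (rule AE_lborel_singleton)
      then show "AE x in lborel. (\<Sum>k. ennreal (pmf (poisson_pmf r) (Suc k)) *
          (ennreal (erlang_density k \<beta> x) * indicator A x)) =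
        (ennreal (pe_density \<kappa> \<beta> x) * indicator A x) * ennreal (pe_series \<kappa> x) * indicator {0<..} x"
      proof eventually_elim
        case (elim x)
        show ?case
        proof (cases "0 < x")
          case True
          have "(\<Sum>k. ennreal (pmf (poisson_pmf r) (Suc k)) *
              (ennreal (erlang_density k \<beta> x) * indicator A x)) =
            (\<Sum>k. ennreal (?t k x) * (ennreal (pe_density \<kappa> \<beta> x) * indicator A x))"
          proof (rule suminf_cong)
            fix k
            have "ennreal (pmf (poisson_pmf r) (Suc k)) * ennreal (erlang_density k \<beta> x) =
                ennreal (?t k x) * ennreal (pe_density \<kappa> \<beta> x)"
              unfolding ennreal_mult'[OF t_nn[OF True], symmetric]
                ennreal_mult'[OF pmf_nonneg, symmetric] term_eq[OF True]
              by (simp add: mult.commute)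
            then show "ennreal (pmf (poisson_pmf r) (Suc k)) *
                (ennreal (erlang_density k \<beta> x) * indicator A x) =
              ennreal (?t k x) * (ennreal (pe_density \<kappa> \<beta> x) * indicator A x)"
              by (simp only: mult.assoc[symmetric])
          qed
          also have "\<dots> = ennreal (pe_series \<kappa> x) * (ennreal (pe_density \<kappa> \<beta> x) * indicator A x)"
            unfolding pe_series_def
            by (simp only: ennreal_suminf_multc suminf_ennreal2[OF t_nn[OF True] summable_t[OF True]])
          finally show ?thesis using True by (simp add: mult.commute)
        next
          case False
          with elim have "x < 0" by simp
          then show ?thesis by (simp add: erlang_density_def)
        qed
      qed
    qed
    finally show ?thesis .
  qed
  also have "ennreal (pe_density \<kappa> \<beta> 0) * indicator A 0 +
      (\<integral>\<^sup>+ x \<in> {0<..}. (ennreal (pe_density \<kappa> \<beta> x) * indicator A x) *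
        ennreal (pe_series \<kappa> x) \<partial>lborel) =
      (\<integral>\<^sup>+ x. ennreal (pe_density \<kappa> \<beta> x) * indicator A x \<partial>pe_base \<kappa>)"
    by (rule nn_integral_pe_base[symmetric]) (simp add: pe_density_def[abs_def])
  also have "\<dots> = emeasure (density (pe_base \<kappa>) (\<lambda>x. ennreal (pe_density \<kappa> \<beta> x))) A"
    by (rule emeasure_density[symmetric]) (auto simp: pe_density_def[abs_def])
  finally show "emeasure (poisson_exponential \<kappa> \<beta>) A =
    emeasure (density (pe_base \<kappa>) (\<lambda>x. ennreal (pe_density \<kappa> \<beta> x))) A" .
qed

end

theory Submission
  imports Defs "HOL-Real_Asymp.Real_Asymp"
begin

text \<open>
  Write \<open>S\<^sub>n\<close> for the sum of the first \<open>n\<close> observations; the likelihood is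
  \<open>exp (- \<beta> S\<^sub>n - n \<kappa> / (2 \<beta>))\<close>.  The family is so special because maximizing this function of
  \<open>\<beta>\<close> and integrating it against Jeffreys' prior give the same answer up to a factor that
  depends on \<open>n\<close> alone.  The maximum is at \<open>\<beta> = sqrt (n \<kappa> / (2 S\<^sub>n))\<close>, where the two terms of the
  exponent coincide, and equals \<open>exp (- sqrt (2 \<kappa> n S\<^sub>n))\<close> (\<open>pe_ml_eq\<close>).  Jeffreys' prior is
  \<open>\<kappa>^(1/2) \<beta>^(-3/2)\<close>, and the integral of the product is the normalizing integral of an inverse
  Gaussian distribution, with value \<open>sqrt (2 \<pi> / n) exp (- sqrt (2 \<kappa> n S\<^sub>n))\<close>
  (\<open>jeffreys_marginal\<close>).  In particular the posterior is inverse Gaussian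
  (\<open>jeffreys_posterior\<close>).

  Bayesian marginals are consistent: by Tonelli's theorem, integrating the marginal of \<open>n\<close>
  observations over the last \<open>n - m\<close> of them gives the marginal of the first \<open>m\<close>
  (\<open>marginal_consistent\<close>).  By proportionality the maximized likelihood satisfies the same
  relation up to the factor \<open>sqrt (n / m)\<close>, which evaluates the normalizer of the CNML predictor
  (\<open>cnml_normalizer\<close>), and the two predictors agree (\<open>cnml_eq_bayes\<close>).

  Two computations feed into this.  The mean and the variance of the family, needed for the
  maximum likelihood estimate and the Fisher information, come from viewing it as a Poisson mixture of
  Erlang distributions.  The inverse Gaussian integral is evaluated through an explicit
  antiderivative built from a primitive of \<open>exp (- z\<^sup>2)\<close>.
\<close>

section \<open>The inverse Gaussian integral\<close>

lemma gaussian_primitive: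
  obtains G :: "real \<Rightarrow> real" where
    "\<And>z. (G has_real_derivative exp (- z\<^sup>2)) (at z)"
    "G 0 = 0"
    "(G \<longlongrightarrow> sqrt pi / 2) at_top"
    "(G \<longlongrightarrow> - sqrt pi / 2) at_bot"
proof -
  have "\<exists>F. \<forall>x. -\<infinity> < ereal x \<longrightarrow> ereal x < \<infinity> \<longrightarrow>
      (F has_vector_derivative exp (- x\<^sup>2)) (at x)"
    by (rule einterval_antiderivative) (auto intro!: continuous_intros)
  then obtain F :: "real \<Rightarrow> real" where F: "(F has_real_derivative exp (- x\<^sup>2)) (at x)" for x
    by (auto simp: has_real_derivative_iff_has_vector_derivative)
  define G where "G z = F z - F 0" for z
  have deriv: "(G has_real_derivative exp (- z\<^sup>2)) (at z)" for z
    unfolding G_def by (auto intro!: derivative_eq_intros F)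
  have odd: "G (- z) = - G z" for z
  proof -
    have "((\<lambda>z. G z + G (- z)) has_real_derivative 0) (at z)" for z
      using DERIV_chain2[OF deriv DERIV_minus[OF DERIV_ident], of z]
      by (auto intro!: derivative_eq_intros deriv)
    from DERIV_isconst_all[OF allI[OF this], of z 0] show ?thesis
      by (simp add: G_def)
  qed
  have eq: "(\<integral>x. indicator {..z} x *\<^sub>R (indicator {0..} x *\<^sub>R exp (- x\<^sup>2)) \<partial>lborel) = G z"
    if "0 \<le> z" for z
  proof -
    have "(\<integral>x. indicator {0..z} x *\<^sub>R exp (- x\<^sup>2) \<partial>lborel) = F z - F 0"
      using that F
      by (intro integral_FTC_Icc) (auto simp: has_real_derivative_iff_has_vector_derivative
            intro: has_vector_derivative_at_within intro!: continuous_intros)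
    then show ?thesis
      by (simp add: G_def indicator_inter_arith[symmetric] mult.assoc[symmetric] Int_commute
          atLeastAtMost_def mult.commute)
  qed
  have top: "(G \<longlongrightarrow> sqrt pi / 2) at_top"
  proof (rule Lim_transform_eventually)
    show "((\<lambda>z. \<integral>x. indicator {..z} x *\<^sub>R (indicator {0..} x *\<^sub>R exp (- x\<^sup>2)) \<partial>lborel)
        \<longlongrightarrow> sqrt pi / 2) at_top"
      using tendsto_integral_at_top[OF sets_lborel, of "\<lambda>x. indicator {0..} x *\<^sub>R exp (- x\<^sup>2)"]
        gaussian_moment_0 unfolding has_bochner_integral_iff by metis
    show "\<forall>\<^sub>F z in at_top. (\<integral>x. indicator {..z} x *\<^sub>R (indicator {0..} x *\<^sub>R exp (- x\<^sup>2)) \<partial>lborel) = G z"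
      using eventually_ge_at_top[of 0] by eventually_elim (rule eq)
  qed
  have "((\<lambda>z. - G (- z)) \<longlongrightarrow> - (sqrt pi / 2)) at_bot"
    by (intro tendsto_minus filterlim_compose[OF top] filterlim_uminus_at_top_at_bot)
  then have bot: "(G \<longlongrightarrow> - sqrt pi / 2) at_bot" by (simp add: odd)
  have "G 0 = 0" by (simp add: G_def)
  then show thesis using deriv top bot by (intro that)
qed

text \<open>Completing the square in two ways,
  \<open>a\<^sup>2/t + b\<^sup>2 t = (a/sqrt t - b sqrt t)\<^sup>2 + 2ab = (a/sqrt t + b sqrt t)\<^sup>2 - 2ab\<close>.  The derivatives of
  the two bracketed quantities add up to \<open>- a / t^(3/2)\<close>, because their \<open>t^(-1/2)\<close> parts cancel; so a
  combination of a Gaussian primitive at these two points is an antiderivative.  This is the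
  familiar expression of the inverse Gaussian distribution function through the normal one.\<close>

lemma inverse_gaussian_integral:
  fixes a b :: real
  assumes a: "0 < a" and b: "0 \<le> b"
  shows "set_integrable lborel {0<..} (\<lambda>t. exp (- b\<^sup>2 * t - a\<^sup>2 / t) / sqrt t ^ 3)"
    and "(LBINT t:{0<..}. exp (- b\<^sup>2 * t - a\<^sup>2 / t) / sqrt t ^ 3) = sqrt pi / a * exp (- 2 * a * b)"
proof -
  obtain G :: "real \<Rightarrow> real" where
    G: "\<And>z. (G has_real_derivative exp (- z\<^sup>2)) (at z)"
    and G0: "G 0 = 0"
    and Gtop: "(G \<longlongrightarrow> sqrt pi / 2) at_top"
    and Gbot: "(G \<longlongrightarrow> - sqrt pi / 2) at_bot"
    using gaussian_primitive by blast
  define u where "u t = a / sqrt t - b * sqrt t" for t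
  define v where "v t = a / sqrt t + b * sqrt t" for t
  define F where "F t = - (exp (- 2 * a * b) * G (u t) + exp (2 * a * b) * G (v t)) / a" for t
  let ?f = "\<lambda>t. exp (- b\<^sup>2 * t - a\<^sup>2 / t) / sqrt t ^ 3"
  have F': "(F has_real_derivative ?f t) (at t)" if t: "0 < t" for t
  proof -
    have s: "0 < sqrt t" "sqrt t \<noteq> 0" "(sqrt t)\<^sup>2 = t" using t by auto
    have u': "(u has_real_derivative (- a / (2 * sqrt t ^ 3) - b / (2 * sqrt t))) (at t)"
      unfolding u_def using t s
      by (auto intro!: derivative_eq_intros simp: field_simps power2_eq_square power3_eq_cube)
    have v': "(v has_real_derivative (- a / (2 * sqrt t ^ 3) + b / (2 * sqrt t))) (at t)"
      unfolding v_def using t s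
      by (auto intro!: derivative_eq_intros simp: field_simps power2_eq_square power3_eq_cube)
    have sq: "(a / sqrt t)\<^sup>2 = a\<^sup>2 / t" "(b * sqrt t)\<^sup>2 = b\<^sup>2 * t" "a / sqrt t * (b * sqrt t) = a * b"
      using s by (simp_all add: power_divide power_mult_distrib)
    have u2: "- 2 * a * b - (u t)\<^sup>2 = - b\<^sup>2 * t - a\<^sup>2 / t"
      unfolding u_def power2_diff sq mult.assoc[of 2] by (simp only: sq)
    have v2: "2 * a * b - (v t)\<^sup>2 = - b\<^sup>2 * t - a\<^sup>2 / t"
      unfolding v_def power2_sum sq mult.assoc[of 2] by (simp only: sq)
    have eu: "exp (- 2 * a * b) * exp (- (u t)\<^sup>2) = exp (- b\<^sup>2 * t - a\<^sup>2 / t)"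
      unfolding u2[symmetric] by (simp add: exp_add[symmetric])
    have ev: "exp (2 * a * b) * exp (- (v t)\<^sup>2) = exp (- b\<^sup>2 * t - a\<^sup>2 / t)"
      unfolding v2[symmetric] by (simp add: exp_add[symmetric])
    have "(F has_real_derivative
        - (exp (- 2 * a * b) * (exp (- (u t)\<^sup>2) * (- a / (2 * sqrt t ^ 3) - b / (2 * sqrt t))) +
           exp (2 * a * b) * (exp (- (v t)\<^sup>2) * (- a / (2 * sqrt t ^ 3) + b / (2 * sqrt t)))) / a) (at t)"
      unfolding F_def
      by (intro DERIV_cdivide DERIV_minus DERIV_add DERIV_cmult DERIV_chain2[OF G u']
          DERIV_chain2[OF G v'])
    also have "- (exp (- 2 * a * b) * (exp (- (u t)\<^sup>2) * (- a / (2 * sqrt t ^ 3) - b / (2 * sqrt t))) +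
           exp (2 * a * b) * (exp (- (v t)\<^sup>2) * (- a / (2 * sqrt t ^ 3) + b / (2 * sqrt t)))) / a = ?f t"
      unfolding mult.assoc[symmetric] eu ev using a s by (simp add: field_simps)
    finally show ?thesis .
  qed
  have pole: "filterlim (\<lambda>t. a / sqrt t) at_top (at_right 0)"
    using a by real_asymp
  have s0: "((\<lambda>t. b * sqrt t) \<longlongrightarrow> 0) (at_right 0)"
    by (auto intro!: tendsto_eq_intros)
  have u0: "filterlim u at_top (at_right 0)"
    unfolding u_def using filterlim_tendsto_add_at_top[OF tendsto_minus[OF s0] pole] by (simp add: add.commute)
  have v0: "filterlim v at_top (at_right 0)"
    unfolding v_def using filterlim_tendsto_add_at_top[OF s0 pole] by (simp add: add.commute)
  have F0: "(F \<longlongrightarrow> - (exp (- 2 * a * b) * (sqrt pi / 2) + exp (2 * a * b) * (sqrt pi / 2)) / a) (at_right 0)"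
    unfolding F_def using a
    by (intro tendsto_intros filterlim_compose[OF Gtop u0] filterlim_compose[OF Gtop v0]) auto
  have Finf: "(F \<longlongrightarrow> - (exp (- 2 * a * b) * (- sqrt pi / 2) + exp (2 * a * b) * (sqrt pi / 2)) / a) at_top"
  \<comment> \<open>For \<open>b = 0\<close> both arguments of \<open>G\<close> tend to 0 instead of to opposite infinities; the limit agrees.\<close>
  proof (cases "b = 0")
    case True
    have G': "isCont G 0" by (rule DERIV_isCont[OF G])
    have "((\<lambda>t. a / sqrt t) \<longlongrightarrow> 0) at_top" by real_asymp
    from isCont_tendsto_compose[OF G' this] have "((\<lambda>t. G (a / sqrt t)) \<longlongrightarrow> 0) at_top"
      by (simp add: G0)
    then have "((\<lambda>t. - (2 * G (a / sqrt t)) / a) \<longlongrightarrow> 0) at_top"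
      using a by (auto intro!: tendsto_eq_intros)
    then show ?thesis
      unfolding F_def u_def v_def by (simp add: True)
  next
    case False
    with b have b': "0 < b" by simp
    have ui: "filterlim u at_bot at_top" unfolding u_def using b' by real_asymp
    have vi: "filterlim v at_top at_top" unfolding v_def using b' by real_asymp
    show ?thesis unfolding F_def using a
      by (intro tendsto_intros filterlim_compose[OF Gbot ui] filterlim_compose[OF Gtop vi]) auto
  qed
  have ei: "einterval 0 \<infinity> = {0 :: real<..}" by (auto simp: einterval_def)
  have cont: "isCont ?f t" if "0 < t" for t
    using that by (intro continuous_intros) auto
  have lim0: "((F \<circ> real_of_ereal) \<longlongrightarrow> - (exp (- 2 * a * b) * (sqrt pi / 2) + exp (2 * a * b) * (sqrt pi / 2)) / a) (at_right 0)"
    using F0 by (simp add: zero_ereal_def ereal_tendsto_simps)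
  have liminf: "((F \<circ> real_of_ereal) \<longlongrightarrow> - (exp (- 2 * a * b) * (- sqrt pi / 2) + exp (2 * a * b) * (sqrt pi / 2)) / a) (at_left \<infinity>)"
    using Finf by (simp add: ereal_tendsto_simps)
  note FTC = interval_integral_FTC_nonneg[of 0 \<infinity> F ?f, OF _ _ _ _ lim0 liminf]
  have "set_integrable lborel (einterval 0 \<infinity>) ?f"
    by (rule FTC(1)) (use F' cont in \<open>auto simp: zero_ereal_def\<close>)
  then show "set_integrable lborel {0<..} ?f" unfolding ei .
  have "(LBINT t=0..\<infinity>. ?f t) = - (exp (- 2 * a * b) * (- sqrt pi / 2) + exp (2 * a * b) * (sqrt pi / 2)) / a
     - (- (exp (- 2 * a * b) * (sqrt pi / 2) + exp (2 * a * b) * (sqrt pi / 2)) / a)"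
    by (rule FTC(2)) (use F' cont in \<open>auto simp: zero_ereal_def\<close>)
  also have "\<dots> = sqrt pi / a * exp (- 2 * a * b)"
    using a by (simp add: field_simps)
  finally show "(LBINT t:{0<..}. ?f t) = sqrt pi / a * exp (- 2 * a * b)"
    by (simp add: interval_lebesgue_integral_def ei)
qed

section \<open>Moments and Fisher information of the family\<close>

text \<open>The series defining the dominating density is matched term by term with the Poisson
  mixture: given \<open>N = k + 1\<close> summands, the sum of exponentials has the Erlang density with index \<open>k\<close>.\<close>

lemma poisson_exponential_density_mixture:
  assumes pos: "0 < \<kappa>" "0 < \<beta>" "0 < x"
  defines "r \<equiv> \<kappa> / (2 * \<beta>)"
  shows "(\<lambda>k. pmf (poisson_pmf r) (Suc k) * erlang_density k \<beta> x) sums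
    (pe_density \<kappa> \<beta> x * pe_series \<kappa> x)"
proof -
  have r: "0 < r" using assms by (simp add: r_def)
  let ?t = "\<lambda>k. (\<kappa> / 2) ^ Suc k * x ^ k / (fact (Suc k) * Gamma (real (Suc k)))"
  have G: "Gamma (real (Suc k)) = fact k" for k
    using Gamma_fact[of k, where 'a = real] by (simp add: add.commute)
  have "summable ?t"
  proof (rule summable_comparison_test')
    show "summable (\<lambda>k. (\<kappa> / 2) * ((\<kappa> / 2 * x) ^ k / fact k))"
      using summable_exp[of "\<kappa> / 2 * x"]
      by (intro summable_mult[of "\<lambda>k. (\<kappa> / 2 * x) ^ k / fact k"])
         (simp only: divide_inverse mult.commute[of "inverse (fact _)"])
    fix k :: nat
    \<comment> \<open>Dropping one of the two factorials leaves an exponential series as a majorant.\<close>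
    have "fact k * 1 \<le> (fact (Suc k) * fact k :: real)"
      by (subst mult.commute) (intro mult_right_mono fact_ge_1, simp)
    then have "(\<kappa> / 2) ^ Suc k * x ^ k / (fact (Suc k) * fact k) \<le> (\<kappa> / 2) ^ Suc k * x ^ k / fact k"
      using pos by (intro divide_left_mono) auto
    then show "norm (?t k) \<le> (\<kappa> / 2) * ((\<kappa> / 2 * x) ^ k / fact k)"
      using pos unfolding G power_mult_distrib[of "\<kappa> / 2" x k]
      by (simp add: mult_ac del: fact_Suc)
  qed
  then have "(\<lambda>k. pe_density \<kappa> \<beta> x * ?t k) sums (pe_density \<kappa> \<beta> x * pe_series \<kappa> x)"
    unfolding pe_series_def by (intro sums_mult summable_sums)
  moreover have "pmf (poisson_pmf r) (Suc k) * erlang_density k \<beta> x = pe_density \<kappa> \<beta> x * ?t k" for k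
  proof -
    have "\<kappa> / 2 = r * \<beta>" using pos by (simp add: r_def)
    then have pow: "(\<kappa> / 2) ^ Suc k = r ^ Suc k * \<beta> ^ Suc k"
      by (simp only: power_mult_distrib)
    have "pe_density \<kappa> \<beta> x = exp (- r) * exp (- \<beta> * x)"
      by (simp add: pe_density_def r_def exp_add[symmetric])
    then show ?thesis
      unfolding G pow pmf_poisson[OF r] using \<open>0 < x\<close>
      by (simp add: erlang_density_def del: fact_Suc power_Suc)
  qed
  ultimately show ?thesis by simp
qed

lemma pe_density_measurable [measurable]: "pe_density \<kappa> \<beta> \<in> borel_measurable borel"
  unfolding pe_density_def[abs_def] by measurable

lemma prob_space_poisson_exponential:
  assumes "0 < \<kappa>" "0 < \<beta>"
  shows "prob_space (poisson_exponential \<kappa> \<beta>)"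
proof -
  let ?E = "density lborel (\<lambda>x. ennreal (exponential_density \<beta> x))"
  interpret E: prob_space ?E
    using assms(2) by (rule prob_space_erlang_density)
  interpret PP: product_prob_space "\<lambda>_. ?E" "UNIV :: nat set" by unfold_locales
  interpret PQ: pair_prob_space "measure_pmf (poisson_pmf (\<kappa> / (2 * \<beta>)))"
    "PiM (UNIV :: nat set) (\<lambda>_. ?E)" by unfold_locales
  have "(\<lambda>(N :: nat, X). \<Sum>i<N. X i) \<in> borel_measurable
      (count_space UNIV \<Otimes>\<^sub>M PiM (UNIV :: nat set) (\<lambda>_. ?E))"
    by (rule measurable_pair_measure_countable1) auto
  also have "\<dots> = borel_measurable (measure_pmf (poisson_pmf (\<kappa> / (2 * \<beta>))) \<Otimes>\<^sub>M
      PiM (UNIV :: nat set) (\<lambda>_. ?E))"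
    by (intro measurable_cong_sets sets_pair_measure_cong) auto
  finally show ?thesis
    unfolding poisson_exponential_def by (rule PQ.prob_space_distr)
qed

lemma nn_integral_pe_density:
  assumes "0 < \<kappa>" "0 < \<beta>"
  shows "(\<integral>\<^sup>+ x. ennreal (pe_density \<kappa> \<beta> x) \<partial>pe_base \<kappa>) = 1"
proof -
  interpret prob_space "poisson_exponential \<kappa> \<beta>"
    using assms by (rule prob_space_poisson_exponential)
  show ?thesis
    using emeasure_space_1 assms
    by (simp add: poisson_exponential_eq_density emeasure_density)
qed

lemma AE_pe_base_nonneg: "AE x in pe_base \<kappa>. 0 \<le> x"
proof (rule AE_I)
  have "{..<0::real} \<inter> {0<..} = {}" by auto
  then show "emeasure (pe_base \<kappa>) {..<0} = 0" by (simp add: emeasure_pe_base)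
qed auto

text \<open>The dominating measure is infinite, but it has a finite density with respect to a member of
  the family.\<close>

lemma sigma_finite_pe_base:
  assumes "0 < \<kappa>"
  shows "sigma_finite_measure (pe_base \<kappa>)"
proof -
  interpret prob_space "poisson_exponential \<kappa> 1"
    using assms by (intro prob_space_poisson_exponential) auto
  have [measurable_cong]: "sets (poisson_exponential \<kappa> 1) = sets borel"
    by (simp add: poisson_exponential_def)
  let ?g = "\<lambda>x. ennreal (1 / pe_density \<kappa> 1 x)"
  have "density (poisson_exponential \<kappa> 1) ?g =
      density (pe_base \<kappa>) (\<lambda>x. ennreal (pe_density \<kappa> 1 x) * ?g x)"
    using assms by (simp add: poisson_exponential_eq_density density_density_eq)
  also have "\<dots> = density (pe_base \<kappa>) (\<lambda>_. 1)"
    by (simp add: ennreal_mult'[symmetric] pe_density_def)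
  finally have "density (poisson_exponential \<kappa> 1) ?g = pe_base \<kappa>"
    by (simp add: density_1)
  moreover have "sigma_finite_measure (density (poisson_exponential \<kappa> 1) ?g)"
    by (subst sigma_finite_iff_density_finite) auto
  ultimately show ?thesis by simp
qed

text \<open>A positive power ignores the atom at 0, so only the Erlang components contribute.\<close>

lemma nn_integral_poisson_exponential_power:
  assumes "0 < \<kappa>" "0 < \<beta>"
  defines "r \<equiv> \<kappa> / (2 * \<beta>)"
  shows "(\<integral>\<^sup>+ x. ennreal (x ^ Suc i) \<partial>poisson_exponential \<kappa> \<beta>) =
    (\<Sum>k. ennreal (pmf (poisson_pmf r) (Suc k) * (fact (k + Suc i) / (fact k * \<beta> ^ Suc i))))"
proof -
  have "(\<integral>\<^sup>+ x. ennreal (x ^ Suc i) \<partial>poisson_exponential \<kappa> \<beta>) =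
      (\<integral>\<^sup>+ x. ennreal (pe_density \<kappa> \<beta> x) * ennreal (x ^ Suc i) \<partial>pe_base \<kappa>)"
    using assms by (simp add: poisson_exponential_eq_density nn_integral_density del: power_Suc)
  also have "\<dots> = (\<integral>\<^sup>+ x \<in> {0<..}. ennreal (pe_density \<kappa> \<beta> x) * ennreal (x ^ Suc i) *
      ennreal (pe_series \<kappa> x) \<partial>lborel)"
    by (subst nn_integral_pe_base) auto
  also have "\<dots> = (\<integral>\<^sup>+ x. (\<Sum>k. ennreal (pmf (poisson_pmf r) (Suc k)) *
      ennreal (erlang_density k \<beta> x * x ^ Suc i)) \<partial>lborel)"
  proof (rule nn_integral_cong)
    fix x :: real
    show "ennreal (pe_density \<kappa> \<beta> x) * ennreal (x ^ Suc i) * ennreal (pe_series \<kappa> x) *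
        indicator {0<..} x = (\<Sum>k. ennreal (pmf (poisson_pmf r) (Suc k)) *
          ennreal (erlang_density k \<beta> x * x ^ Suc i))"
    proof (cases "0 < x")
      case True
      have mix: "(\<lambda>k. pmf (poisson_pmf r) (Suc k) * erlang_density k \<beta> x * x ^ Suc i) sums
        (pe_density \<kappa> \<beta> x * pe_series \<kappa> x * x ^ Suc i)"
        unfolding r_def by (intro sums_mult2 poisson_exponential_density_mixture assms True)
      have nn: "0 \<le> pmf (poisson_pmf r) (Suc k) * erlang_density k \<beta> x * x ^ Suc i" for k
        using True assms by (intro mult_nonneg_nonneg erlang_density_nonneg pmf_nonneg) auto
      have "(\<Sum>k. ennreal (pmf (poisson_pmf r) (Suc k)) * ennreal (erlang_density k \<beta> x * x ^ Suc i))
        = (\<Sum>k. ennreal (pmf (poisson_pmf r) (Suc k) * erlang_density k \<beta> x * x ^ Suc i))"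
        by (simp add: ennreal_mult'[symmetric] mult.assoc)
      also have "\<dots> = ennreal (pe_density \<kappa> \<beta> x * pe_series \<kappa> x * x ^ Suc i)"
        using suminf_ennreal2[OF nn sums_summable[OF mix]] sums_unique[OF mix] by simp
      also have "\<dots> = ennreal (pe_density \<kappa> \<beta> x) * ennreal (x ^ Suc i) * ennreal (pe_series \<kappa> x)"
        using True by (simp add: ennreal_mult'[symmetric] ennreal_mult''[symmetric] pe_density_def mult_ac)
      finally show ?thesis using True by simp
    next
      case False
      then show ?thesis by (cases "x = 0") (auto simp: erlang_density_def)
    qed
  qed
  also have "\<dots> = (\<Sum>k. ennreal (pmf (poisson_pmf r) (Suc k)) *
      (\<integral>\<^sup>+ x. ennreal (erlang_density k \<beta> x * x ^ Suc i) \<partial>lborel))"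
    by (subst nn_integral_suminf) (auto simp: nn_integral_cmult)
  also have "\<dots> = (\<Sum>k. ennreal (pmf (poisson_pmf r) (Suc k) * (fact (k + Suc i) / (fact k * \<beta> ^ Suc i))))"
    unfolding nn_integral_erlang_ith_moment[OF assms(2)]
    by (simp only: ennreal_mult'[OF pmf_nonneg])
  finally show ?thesis .
qed

lemma poisson_pmf_sums:
  assumes "0 < r"
  shows "pmf (poisson_pmf r) sums 1"
    and "(\<lambda>k. real k * pmf (poisson_pmf r) k) sums r"
    and "pmf (poisson_pmf r) (Suc k) * real (Suc k) = r * pmf (poisson_pmf r) k"
proof -
  have rec: "pmf (poisson_pmf r) (Suc k) * real (Suc k) = r * pmf (poisson_pmf r) k" for k
    using assms by (simp add: divide_simps)
  then show "pmf (poisson_pmf r) (Suc k) * real (Suc k) = r * pmf (poisson_pmf r) k" .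
  have "(\<lambda>k. r ^ k /\<^sub>R fact k * exp (- r)) sums (exp r * exp (- r))"
    by (intro sums_mult2 exp_converges)
  moreover have "pmf (poisson_pmf r) = (\<lambda>k. r ^ k /\<^sub>R fact k * exp (- r))"
    using assms by (simp add: fun_eq_iff divide_inverse mult_ac)
  ultimately show one: "pmf (poisson_pmf r) sums 1"
    by (simp add: exp_add[symmetric] del: pmf_poisson)
  have "(\<lambda>k. real (Suc k) * pmf (poisson_pmf r) (Suc k)) sums r"
    using sums_mult[OF one, of r] by (simp only: rec mult.commute[of "real (Suc _)"] mult_1_right)
  then show "(\<lambda>k. real k * pmf (poisson_pmf r) k) sums r"
    using sums_Suc_iff[of "\<lambda>k. real k * pmf (poisson_pmf r) k" r] by simp
qed

lemma has_bochner_integral_poisson_exponential_power: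
  assumes "0 < \<kappa>" "0 < \<beta>"
    and sums: "(\<lambda>k. pmf (poisson_pmf (\<kappa> / (2 * \<beta>))) (Suc k) *
      (fact (k + Suc i) / (fact k * \<beta> ^ Suc i))) sums s"
  shows "has_bochner_integral (poisson_exponential \<kappa> \<beta>) (\<lambda>x. x ^ Suc i) s"
proof (rule has_bochner_integral_nn_integral)
  have [measurable_cong]: "sets (poisson_exponential \<kappa> \<beta>) = sets borel"
    by (simp add: poisson_exponential_def)
  show "(\<lambda>x. x ^ Suc i) \<in> borel_measurable (poisson_exponential \<kappa> \<beta>)" by measurable
  have "AE x in poisson_exponential \<kappa> \<beta>. 0 \<le> x"
    unfolding poisson_exponential_eq_density[OF assms(1,2)]
    using AE_pe_base_nonneg[of \<kappa>] by (subst AE_density) auto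
  then show "AE x in poisson_exponential \<kappa> \<beta>. 0 \<le> x ^ Suc i"
    by eventually_elim (rule zero_le_power)
  have nn: "0 \<le> pmf (poisson_pmf (\<kappa> / (2 * \<beta>))) (Suc k) *
      (fact (k + Suc i) / (fact k * \<beta> ^ Suc i))" for k
    using assms(2) by (intro mult_nonneg_nonneg pmf_nonneg divide_nonneg_nonneg) auto
  show "0 \<le> s" using sums_le[OF nn sums_zero sums] .
  show "(\<integral>\<^sup>+ x. ennreal (x ^ Suc i) \<partial>poisson_exponential \<kappa> \<beta>) = ennreal s"
    unfolding nn_integral_poisson_exponential_power[OF assms(1,2)]
    using suminf_ennreal2[OF nn sums_summable[OF sums]] sums_unique[OF sums] by simp
qed

lemma poisson_exponential_mean:
  assumes "0 < \<kappa>" "0 < \<beta>"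
  shows "has_bochner_integral (poisson_exponential \<kappa> \<beta>) (\<lambda>x. x) (\<kappa> / (2 * \<beta>\<^sup>2))"
proof -
  define r where "r = \<kappa> / (2 * \<beta>)"
  have r: "0 < r" using assms by (simp add: r_def)
  have "(\<lambda>k. r * pmf (poisson_pmf r) k / \<beta>) sums (r * 1 / \<beta>)"
    by (intro sums_divide sums_mult poisson_pmf_sums r)
  also have "(\<lambda>k. r * pmf (poisson_pmf r) k / \<beta>) =
      (\<lambda>k. pmf (poisson_pmf r) (Suc k) * (fact (k + Suc 0) / (fact k * \<beta> ^ Suc 0)))"
    unfolding poisson_pmf_sums(3)[OF r, symmetric] by (simp add: fun_eq_iff)
  finally show ?thesis
    using has_bochner_integral_poisson_exponential_power[OF assms, of 0 "r / \<beta>"]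
    by (simp add: r_def power2_eq_square mult.assoc)
qed

lemma poisson_exponential_second_moment:
  assumes "0 < \<kappa>" "0 < \<beta>"
  shows "has_bochner_integral (poisson_exponential \<kappa> \<beta>) (\<lambda>x. x\<^sup>2)
    ((\<kappa> / (2 * \<beta>\<^sup>2))\<^sup>2 + \<kappa> / \<beta> ^ 3)"
proof -
  define r where "r = \<kappa> / (2 * \<beta>)"
  have r: "0 < r" using assms by (simp add: r_def)
  have "(\<lambda>k. r * (real k * pmf (poisson_pmf r) k + 2 * pmf (poisson_pmf r) k) / \<beta>\<^sup>2) sums
      (r * (r + 2 * 1) / \<beta>\<^sup>2)"
    by (intro sums_divide sums_mult sums_add poisson_pmf_sums r)
  also have "(\<lambda>k. r * (real k * pmf (poisson_pmf r) k + 2 * pmf (poisson_pmf r) k) / \<beta>\<^sup>2) =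
      (\<lambda>k. pmf (poisson_pmf r) (Suc k) * (fact (k + Suc 1) / (fact k * \<beta> ^ Suc 1)))"
  proof
    fix k
    have "r * (real k * pmf (poisson_pmf r) k + 2 * pmf (poisson_pmf r) k) =
        (pmf (poisson_pmf r) (Suc k) * real (Suc k)) * (real k + 2)"
      unfolding poisson_pmf_sums(3)[OF r] by (simp add: algebra_simps)
    then show "r * (real k * pmf (poisson_pmf r) k + 2 * pmf (poisson_pmf r) k) / \<beta>\<^sup>2 =
        pmf (poisson_pmf r) (Suc k) * (fact (k + Suc 1) / (fact k * \<beta> ^ Suc 1))"
      using assms by (simp add: field_simps power2_eq_square del: pmf_poisson)
  qed
  also have "r * (r + 2 * 1) / \<beta>\<^sup>2 = (\<kappa> / (2 * \<beta>\<^sup>2))\<^sup>2 + \<kappa> / \<beta> ^ 3"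
    using assms by (simp add: r_def field_simps power2_eq_square power3_eq_cube)
  finally show ?thesis
    using has_bochner_integral_poisson_exponential_power[OF assms, of 1]
    by (simp add: r_def numeral_2_eq_2)
qed

text \<open>The score is the mean minus the observation, so the information is the variance.\<close>

lemma pe_fisher_information:
  assumes "0 < \<kappa>" "0 < \<beta>"
  shows "pe_fisher_information \<kappa> \<beta> = \<kappa> / \<beta> ^ 3"
proof -
  interpret prob_space "poisson_exponential \<kappa> \<beta>"
    using assms by (rule prob_space_poisson_exponential)
  define \<mu> where "\<mu> = \<kappa> / (2 * \<beta>\<^sup>2)"
  have "deriv (\<lambda>b. ln (pe_density \<kappa> b x)) \<beta> = \<mu> - x" for x
  proof -
    have "((\<lambda>b. - b * x - \<kappa> / (2 * b)) has_real_derivative (\<mu> - x)) (at \<beta>)"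
      using assms unfolding \<mu>_def
      by (auto intro!: derivative_eq_intros simp: field_simps power2_eq_square)
    then show ?thesis unfolding pe_density_def ln_exp by (rule DERIV_imp_deriv)
  qed
  then have "pe_fisher_information \<kappa> \<beta> = (\<integral> x. (\<mu> - x)\<^sup>2 \<partial>poisson_exponential \<kappa> \<beta>)"
    by (simp only: pe_fisher_information_def)
  also have "\<dots> = (\<integral> x. \<mu>\<^sup>2 - 2 * \<mu> * x + x\<^sup>2 \<partial>poisson_exponential \<kappa> \<beta>)"
    by (simp add: power2_diff algebra_simps)
  also have "\<dots> = \<mu>\<^sup>2 - 2 * \<mu> * \<mu> + (\<mu>\<^sup>2 + \<kappa> / \<beta> ^ 3)"
    using poisson_exponential_mean[OF assms] poisson_exponential_second_moment[OF assms]
    by (simp add: has_bochner_integral_iff \<mu>_def prob_space)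
  finally show ?thesis by (simp add: power2_eq_square)
qed

section \<open>Jeffreys' prior and its marginal likelihoods\<close>

lemma jeffreys_prior_eq:
  assumes "0 < \<kappa>" "0 < \<beta>"
  shows "jeffreys_prior \<kappa> \<beta> = sqrt \<kappa> / sqrt \<beta> ^ 3"
  using assms by (simp add: jeffreys_prior_def pe_fisher_information real_sqrt_divide real_sqrt_power)

lemma pe_lik_eq:
  "pe_lik \<kappa> \<beta> n x = exp (- \<beta> * (\<Sum>i\<in>{1..n}. x i) - real n * \<kappa> / (2 * \<beta>))"
  by (simp add: pe_lik_def pe_density_def exp_sum[symmetric] sum_subtractf sum_distrib_left
      sum_negf)

lemma jeffreys_marginal:
  fixes x :: "nat \<Rightarrow> real"
  assumes "0 < \<kappa>" "0 < n" and S: "0 \<le> (\<Sum>i\<in>{1..n}. x i)"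
  shows "set_integrable lborel {0<..} (\<lambda>\<beta>. pe_lik \<kappa> \<beta> n x * jeffreys_prior \<kappa> \<beta>)"
    and "pe_marginal \<kappa> (jeffreys_prior \<kappa>) n x =
      sqrt (2 * pi / real n) * exp (- sqrt (2 * \<kappa> * real n * (\<Sum>i\<in>{1..n}. x i)))"
proof -
  define a where "a = sqrt (real n * \<kappa> / 2)"
  define b where "b = sqrt (\<Sum>i\<in>{1..n}. x i)"
  let ?f = "\<lambda>t. exp (- b\<^sup>2 * t - a\<^sup>2 / t) / sqrt t ^ 3"
  have a: "0 < a" "a\<^sup>2 = real n * \<kappa> / 2" and b: "0 \<le> b" "b\<^sup>2 = (\<Sum>i\<in>{1..n}. x i)"
    using assms by (simp_all add: a_def b_def sum_nonneg)
  have eq: "pe_lik \<kappa> t n x * jeffreys_prior \<kappa> t = sqrt \<kappa> * ?f t" if "t \<in> {0<..}" for t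
    using that assms(1) unfolding a(2) b(2) by (simp add: pe_lik_eq jeffreys_prior_eq mult.commute)
  note int = inverse_gaussian_integral[OF a(1) b(1)]
  have "set_integrable lborel {0<..} (\<lambda>t. sqrt \<kappa> * ?f t)"
    using int(1) by (intro set_integrable_mult_right)
  then show "set_integrable lborel {0<..} (\<lambda>t. pe_lik \<kappa> t n x * jeffreys_prior \<kappa> t)"
    by (subst set_integrable_cong[OF refl refl eq]) auto
  have "2 * a * b = sqrt (2 * \<kappa> * real n * (\<Sum>i\<in>{1..n}. x i))"
  proof -
    have "(2 :: real) = sqrt 4" by simp
    then have "2 * a * b = sqrt 4 * a * b" by (simp only:)
    then show ?thesis
      unfolding a_def b_def real_sqrt_mult[symmetric] by (simp add: mult_ac)
  qed
  then have e: "exp (- 2 * a * b) = exp (- sqrt (2 * \<kappa> * real n * (\<Sum>i\<in>{1..n}. x i)))" by simp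
  have "pe_marginal \<kappa> (jeffreys_prior \<kappa>) n x = (LBINT t:{0<..}. sqrt \<kappa> * ?f t)"
    unfolding pe_marginal_def using eq by (intro set_lebesgue_integral_cong) auto
  also have "\<dots> = sqrt \<kappa> * (sqrt pi / a * exp (- 2 * a * b))"
    unfolding int(2)[symmetric] by (rule set_integral_mult_right)
  also have "\<dots> =
    sqrt (2 * pi / real n) * exp (- sqrt (2 * \<kappa> * real n * (\<Sum>i\<in>{1..n}. x i)))"
  proof -
    have "sqrt \<kappa> * (sqrt pi / a) = sqrt (\<kappa> * pi / (real n * \<kappa> / 2))"
      unfolding a_def by (simp add: real_sqrt_mult real_sqrt_divide)
    also have "\<kappa> * pi / (real n * \<kappa> / 2) = 2 * pi / real n"
      using assms by (simp add: field_simps)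
    finally show ?thesis by (simp only: mult.assoc[symmetric] e)
  qed
  finally show "pe_marginal \<kappa> (jeffreys_prior \<kappa>) n x =
      sqrt (2 * pi / real n) * exp (- sqrt (2 * \<kappa> * real n * (\<Sum>i\<in>{1..n}. x i)))" .
qed

text \<open>Without data the marginal is the integral of Jeffreys' prior, which diverges and so has the
  default value 0.  The scaling \<open>t \<mapsto> 4 t\<close> turns the integral of \<open>t^(-3/2)\<close> into half of itself, which leaves
  0 as the only possible value.\<close>

lemma jeffreys_marginal_no_data: "pe_marginal \<kappa> (jeffreys_prior \<kappa>) 0 x = 0" if "0 < \<kappa>"
proof -
  define f where "f t = indicator {0<..} t * (1 / sqrt t ^ 3)" for t :: real
  have scale: "f (0 + 4 * t) = f t / 8" for t
    by (simp add: f_def real_sqrt_mult power_mult_distrib zero_less_mult_iff split: split_indicator)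
  have "(\<integral>t. f t \<partial>lborel) = 4 * (\<integral>t. f t / 8 \<partial>lborel)"
    unfolding scale[symmetric] by (subst lborel_integral_real_affine[of 4 f 0]) simp_all
  also have "\<dots> = (\<integral>t. f t \<partial>lborel) / 2" by simp
  finally have "(\<integral>t. f t \<partial>lborel) = 0" by simp
  moreover have "pe_marginal \<kappa> (jeffreys_prior \<kappa>) 0 x = (\<integral>t. sqrt \<kappa> * f t \<partial>lborel)"
    unfolding pe_marginal_def set_lebesgue_integral_def using that
    by (intro Bochner_Integration.integral_cong refl)
       (auto simp: pe_lik_def f_def jeffreys_prior_eq split: split_indicator)
  ultimately show ?thesis by simp
qed

section \<open>Maximum likelihood and the equality of the predictors\<close>

lemma is_pe_mle_iff:
  assumes "0 < \<kappa>"
  shows "is_pe_mle \<kappa> n x \<beta> \<longleftrightarrow>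
    0 < n \<and> 0 < (\<Sum>i\<in>{1..n}. x i) \<and> \<beta> = sqrt (real n * \<kappa> / (2 * (\<Sum>i\<in>{1..n}. x i)))"
proof -
  define S where "S = (\<Sum>i\<in>{1..n}. x i)"
  have "is_pe_mle \<kappa> n x \<beta> \<longleftrightarrow> 0 < \<beta> \<and> \<kappa> / (2 * \<beta>\<^sup>2) = S / real n"
    using poisson_exponential_mean[OF assms, of \<beta>] has_bochner_integral_eq
    unfolding is_pe_mle_def S_def by metis
  also have "\<dots> \<longleftrightarrow> 0 < n \<and> 0 < S \<and> \<beta> = sqrt (real n * \<kappa> / (2 * S))"
  proof (intro iffI; elim conjE)
    assume \<beta>: "0 < \<beta>" and eq: "\<kappa> / (2 * \<beta>\<^sup>2) = S / real n"
    have "0 < \<kappa> / (2 * \<beta>\<^sup>2)" using assms \<beta> by simp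
    then have pos: "0 < n" "0 < S" unfolding eq by (auto simp: zero_less_divide_iff)
    have "\<beta>\<^sup>2 = real n * \<kappa> / (2 * S)"
      using eq pos \<beta> by (simp add: field_simps)
    then show "0 < n \<and> 0 < S \<and> \<beta> = sqrt (real n * \<kappa> / (2 * S))"
      using pos \<beta> by (metis less_imp_le real_sqrt_unique)
  next
    assume pos: "0 < n" "0 < S" and eq: "\<beta> = sqrt (real n * \<kappa> / (2 * S))"
    have "\<beta>\<^sup>2 = real n * \<kappa> / (2 * S)" using pos assms by (simp add: eq)
    then show "0 < \<beta> \<and> \<kappa> / (2 * \<beta>\<^sup>2) = S / real n"
      using pos assms by (simp add: eq)
  qed
  finally show ?thesis unfolding S_def .
qed

lemma ex1_pe_mle_iff:
  assumes "0 < \<kappa>"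
  shows "(\<exists>!\<beta>. is_pe_mle \<kappa> n x \<beta>) \<longleftrightarrow> 0 < n \<and> 0 < (\<Sum>i\<in>{1..n}. x i)"
  unfolding is_pe_mle_iff[OF assms] by auto

lemma pe_ml_eq:
  assumes "0 < \<kappa>" "0 < n" and S: "0 < (\<Sum>i\<in>{1..n}. x i)"
  shows "pe_ml \<kappa> n x = exp (- sqrt (2 * \<kappa> * real n * (\<Sum>i\<in>{1..n}. x i)))"
proof -
  define S where "S = (\<Sum>i\<in>{1..n}. x i)"
  define b where "b = sqrt (real n * \<kappa> / (2 * S))"
  have S': "0 < S" using S by (simp add: S_def)
  have mle: "pe_mle \<kappa> n x = b"
    unfolding pe_mle_def is_pe_mle_iff[OF assms(1)] using assms by (simp add: b_def S_def)
  have b: "0 < b" "b\<^sup>2 = real n * \<kappa> / (2 * S)" using assms(1,2) S' by (simp_all add: b_def)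
  have half: "real n * \<kappa> / (2 * b) = b * S"
    using b S' by (simp add: field_simps power2_eq_square)
  have "2 * (b * S) = sqrt (2 * \<kappa> * real n * S)"
  proof (rule real_sqrt_unique[symmetric])
    show "(2 * (b * S))\<^sup>2 = 2 * \<kappa> * real n * S"
      using S' by (simp add: power_mult_distrib b(2)) (simp add: power2_eq_square)
  qed (use b S' in simp)
  then have "- b * S - real n * \<kappa> / (2 * b) = - sqrt (2 * \<kappa> * real n * S)"
    unfolding half by linarith
  then show ?thesis
    unfolding pe_ml_def mle pe_lik_eq by (simp only: S_def)
qed

lemma sum_append_sample:
  assumes "m \<le> n"
  shows "(\<Sum>i\<in>{1..n}. append_sample m x y i) = (\<Sum>i\<in>{1..m}. x i) + (\<Sum>i\<in>{m+1..n}. y i)"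
proof -
  have "{1..n} = {1..m} \<union> {m+1..n}" using assms by auto
  then have "(\<Sum>i\<in>{1..n}. append_sample m x y i) =
      (\<Sum>i\<in>{1..m}. append_sample m x y i) + (\<Sum>i\<in>{m+1..n}. append_sample m x y i)"
    by (simp only:) (rule sum.union_disjoint; auto)
  then show ?thesis by (simp add: append_sample_def)
qed

lemma pe_lik_append_sample:
  assumes "m \<le> n"
  shows "pe_lik \<kappa> \<beta> n (append_sample m x y) =
    pe_lik \<kappa> \<beta> m x * (\<Prod>i\<in>{m+1..n}. pe_density \<kappa> \<beta> (y i))"
proof -
  have "{1..n} = {1..m} \<union> {m+1..n}" using assms by auto
  then have "pe_lik \<kappa> \<beta> n (append_sample m x y) =
      (\<Prod>i\<in>{1..m}. pe_density \<kappa> \<beta> (append_sample m x y i)) *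
      (\<Prod>i\<in>{m+1..n}. pe_density \<kappa> \<beta> (append_sample m x y i))"
    unfolding pe_lik_def by (simp only:) (rule prod.union_disjoint; auto)
  then show ?thesis by (simp add: append_sample_def pe_lik_def)
qed

lemma sum_append_sample_measurable [measurable]:
  "(\<lambda>y. \<Sum>i\<in>{1..n}. append_sample m x y i) \<in> borel_measurable (\<Pi>\<^sub>M i\<in>{m+1..n}. pe_base \<kappa>)"
proof (rule borel_measurable_sum)
  fix i assume "i \<in> {1..n}"
  then show "(\<lambda>y. append_sample m x y i) \<in> borel_measurable (\<Pi>\<^sub>M i\<in>{m+1..n}. pe_base \<kappa>)"
    unfolding append_sample_def by (cases "i \<le> m") auto
qed

text \<open>On samples with a non-positive sum the estimate is the default value of a description
  without a witness.  It is the same for all such samples, so measurability holds there too.\<close>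

lemma pe_ml_append_sample_measurable [measurable]:
  assumes "0 < \<kappa>"
  shows "(\<lambda>y. pe_ml \<kappa> n (append_sample m x y)) \<in> borel_measurable (\<Pi>\<^sub>M i\<in>{m+1..n}. pe_base \<kappa>)"
proof -
  define S where "S y = (\<Sum>i\<in>{1..n}. append_sample m x y i)" for y
  have [measurable]: "S \<in> borel_measurable (\<Pi>\<^sub>M i\<in>{m+1..n}. pe_base \<kappa>)"
    unfolding S_def by measurable
  define d where "d = (THE \<beta> :: real. False)"
  have "pe_ml \<kappa> n (append_sample m x y) =
    (if 0 < n \<and> 0 < S y then exp (- sqrt (2 * \<kappa> * real n * S y))
     else exp (- d * S y - real n * \<kappa> / (2 * d)))" for y
  proof (cases "0 < n \<and> 0 < S y")
    case True
    then show ?thesis using pe_ml_eq[OF assms] by (simp add: S_def)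
  next
    case False
    then have "is_pe_mle \<kappa> n (append_sample m x y) = (\<lambda>_. False)"
      unfolding is_pe_mle_iff[OF assms] S_def by auto
    then have "pe_mle \<kappa> n (append_sample m x y) = d"
      by (simp add: pe_mle_def d_def)
    then show ?thesis using False by (auto simp: pe_ml_def pe_lik_eq S_def)
  qed
  then show ?thesis by (simp only:) measurable
qed

lemma product_sigma_finite_pe_base:
  "0 < \<kappa> \<Longrightarrow> product_sigma_finite (\<lambda>_ :: nat. pe_base \<kappa>)"
  by (simp add: product_sigma_finite_def sigma_finite_pe_base)

text \<open>After exchanging the integrals, each new observation contributes the total mass 1 of a
  member of the family.\<close>

lemma marginal_consistent:
  assumes "0 < \<kappa>" "m \<le> n" and [measurable]: "prior \<in> borel_measurable borel"
    and "\<And>\<beta>. 0 < \<beta> \<Longrightarrow> 0 \<le> prior \<beta>"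
  shows "(\<integral>\<^sup>+ y. (\<integral>\<^sup>+ \<beta> \<in> {0<..}. ennreal (pe_lik \<kappa> \<beta> n (append_sample m x y) * prior \<beta>) \<partial>lborel)
      \<partial>(\<Pi>\<^sub>M i\<in>{m+1..n}. pe_base \<kappa>)) =
    (\<integral>\<^sup>+ \<beta> \<in> {0<..}. ennreal (pe_lik \<kappa> \<beta> m x * prior \<beta>) \<partial>lborel)"
proof -
  interpret P: product_sigma_finite "\<lambda>_ :: nat. pe_base \<kappa>"
    using assms(1) by (rule product_sigma_finite_pe_base)
  let ?P = "\<Pi>\<^sub>M i\<in>{m+1..n}. pe_base \<kappa>"
  interpret Q: sigma_finite_measure ?P by (rule P.sigma_finite) simp
  interpret PQ: pair_sigma_finite lborel ?P ..
  have "(\<integral>\<^sup>+ y. (\<integral>\<^sup>+ \<beta> \<in> {0<..}. ennreal (pe_lik \<kappa> \<beta> n (append_sample m x y) * prior \<beta>) \<partial>lborel) \<partial>?P) =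
    (\<integral>\<^sup>+ \<beta>. (\<integral>\<^sup>+ y. ennreal (pe_lik \<kappa> \<beta> n (append_sample m x y) * prior \<beta>) * indicator {0<..} \<beta> \<partial>?P) \<partial>lborel)"
    unfolding pe_lik_eq by (rule PQ.Fubini') measurable
  also have "\<dots> = (\<integral>\<^sup>+ \<beta> \<in> {0<..}. ennreal (pe_lik \<kappa> \<beta> m x * prior \<beta>) \<partial>lborel)"
  proof (rule nn_integral_cong)
    fix \<beta> :: real
    show "(\<integral>\<^sup>+ y. ennreal (pe_lik \<kappa> \<beta> n (append_sample m x y) * prior \<beta>) * indicator {0<..} \<beta> \<partial>?P) =
      ennreal (pe_lik \<kappa> \<beta> m x * prior \<beta>) * indicator {0<..} \<beta>"
    proof (cases "0 < \<beta>")
      case True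
      have nn: "0 \<le> pe_lik \<kappa> \<beta> m x * prior \<beta>" "0 \<le> pe_density \<kappa> \<beta> t" for t
        using assms(4)[OF True] by (simp_all add: pe_lik_eq pe_density_def)
      have "ennreal (pe_lik \<kappa> \<beta> n (append_sample m x y) * prior \<beta>) =
        ennreal (pe_lik \<kappa> \<beta> m x * prior \<beta>) * (\<Prod>i\<in>{m+1..n}. ennreal (pe_density \<kappa> \<beta> (y i)))" for y
        unfolding pe_lik_append_sample[OF assms(2)] prod_ennreal[OF nn(2)]
          ennreal_mult'[OF nn(1), symmetric] by (simp add: mult_ac)
      then have "(\<integral>\<^sup>+ y. ennreal (pe_lik \<kappa> \<beta> n (append_sample m x y) * prior \<beta>) \<partial>?P) =
        ennreal (pe_lik \<kappa> \<beta> m x * prior \<beta>) *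
          (\<integral>\<^sup>+ y. (\<Prod>i\<in>{m+1..n}. ennreal (pe_density \<kappa> \<beta> (y i))) \<partial>?P)"
        by (simp only:) (rule nn_integral_cmult, measurable)
      also have "(\<integral>\<^sup>+ y. (\<Prod>i\<in>{m+1..n}. ennreal (pe_density \<kappa> \<beta> (y i))) \<partial>?P) = 1"
        using True assms(1) by (subst P.product_nn_integral_prod) (simp_all add: nn_integral_pe_density)
      finally show ?thesis using True by simp
    qed simp
  qed
  finally show ?thesis .
qed

text \<open>Almost everywhere the maximized likelihood is \<open>sqrt (n / (2 \<pi>))\<close> times the Jeffreys marginal,
  so the integral over continuations is inherited from \<open>marginal_consistent\<close>.  The hypothesis on
  continuations says that the estimate exists almost surely; it fails exactly when the given observations sum to 0,
  because then the atom of the dominating measure at 0 gives positive mass to the zero continuation.\<close>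

lemma cnml_normalizer:
  fixes x :: "nat \<Rightarrow> real"
  assumes "0 < \<kappa>" "0 < m" "m \<le> n" and S: "0 \<le> (\<Sum>i\<in>{1..m}. x i)"
    and AE: "AE y in (\<Pi>\<^sub>M i\<in>{m+1..n}. pe_base \<kappa>). 0 < (\<Sum>i\<in>{1..n}. append_sample m x y i)"
  shows "has_bochner_integral (\<Pi>\<^sub>M i\<in>{m+1..n}. pe_base \<kappa>) (\<lambda>y. pe_ml \<kappa> n (append_sample m x y))
    (sqrt (real n / real m) * exp (- sqrt (2 * \<kappa> * real m * (\<Sum>i\<in>{1..m}. x i))))"
proof (rule has_bochner_integral_nn_integral)
  let ?P = "\<Pi>\<^sub>M i\<in>{m+1..n}. pe_base \<kappa>"
  let ?prior = "\<lambda>\<beta>. sqrt \<kappa> / sqrt \<beta> ^ 3"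
  have n: "0 < n" using assms by simp
  have nn: "(\<integral>\<^sup>+ \<beta> \<in> {0<..}. ennreal (pe_lik \<kappa> \<beta> k z * ?prior \<beta>) \<partial>lborel) =
    ennreal (sqrt (2 * pi / real k) * exp (- sqrt (2 * \<kappa> * real k * (\<Sum>i\<in>{1..k}. z i))))"
    if k: "0 < k" and z: "0 \<le> (\<Sum>i\<in>{1..k}. z i)" for k and z :: "nat \<Rightarrow> real"
  proof -
    note J = jeffreys_marginal[OF assms(1) k z]
    have "(\<integral>\<^sup>+ \<beta> \<in> {0<..}. ennreal (pe_lik \<kappa> \<beta> k z * ?prior \<beta>) \<partial>lborel) =
      (\<integral>\<^sup>+ \<beta>. ennreal (indicator {0<..} \<beta> *\<^sub>R (pe_lik \<kappa> \<beta> k z * jeffreys_prior \<kappa> \<beta>)) \<partial>lborel)"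
      using assms(1) by (intro nn_integral_cong) (auto simp: jeffreys_prior_eq split: split_indicator)
    also have "\<dots> = ennreal (pe_marginal \<kappa> (jeffreys_prior \<kappa>) k z)"
      unfolding pe_marginal_def set_lebesgue_integral_def
      using J(1) assms(1) unfolding set_integrable_def
      by (intro nn_integral_eq_integral)
         (auto simp: jeffreys_prior_eq pe_lik_eq split: split_indicator)
    finally show ?thesis unfolding J(2) .
  qed
  show "(\<lambda>y. pe_ml \<kappa> n (append_sample m x y)) \<in> borel_measurable ?P"
    using assms(1) by measurable
  show "AE y in ?P. 0 \<le> pe_ml \<kappa> n (append_sample m x y)"
    by (simp add: pe_ml_def pe_lik_eq)
  show "0 \<le> sqrt (real n / real m) * exp (- sqrt (2 * \<kappa> * real m * (\<Sum>i\<in>{1..m}. x i)))"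
    by simp
  let ?M = "\<lambda>y. \<integral>\<^sup>+ \<beta> \<in> {0<..}. ennreal (pe_lik \<kappa> \<beta> n (append_sample m x y) * ?prior \<beta>) \<partial>lborel"
  have "AE y in ?P. ennreal (pe_ml \<kappa> n (append_sample m x y)) = ennreal (sqrt (real n / (2 * pi))) * ?M y"
    using AE
  proof eventually_elim
    case (elim y)
    have "sqrt (real n / (2 * pi)) * sqrt (2 * pi / real n) = 1"
      using n by (simp add: real_sqrt_mult[symmetric])
    then show ?case
      unfolding nn[OF n less_imp_le[OF elim]] pe_ml_eq[OF assms(1) n elim]
      by (simp add: ennreal_mult'[symmetric] mult.assoc[symmetric])
  qed
  then have "(\<integral>\<^sup>+ y. ennreal (pe_ml \<kappa> n (append_sample m x y)) \<partial>?P) =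
      (\<integral>\<^sup>+ y. ennreal (sqrt (real n / (2 * pi))) * ?M y \<partial>?P)"
    by (rule nn_integral_cong_AE)
  also have "\<dots> = ennreal (sqrt (real n / (2 * pi))) * (\<integral>\<^sup>+ y. ?M y \<partial>?P)"
    unfolding pe_lik_eq by (rule nn_integral_cmult) measurable
  also have "(\<integral>\<^sup>+ y. ?M y \<partial>?P) = (\<integral>\<^sup>+ \<beta> \<in> {0<..}. ennreal (pe_lik \<kappa> \<beta> m x * ?prior \<beta>) \<partial>lborel)"
    using assms(1,3) by (intro marginal_consistent) auto
  also have "ennreal (sqrt (real n / (2 * pi))) * \<dots> = ennreal (sqrt (real n / real m) *
      exp (- sqrt (2 * \<kappa> * real m * (\<Sum>i\<in>{1..m}. x i))))"
  proof -
    have "sqrt (real n / (2 * pi)) * sqrt (2 * pi / real m) = sqrt (real n / real m)"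
      by (simp add: real_sqrt_mult[symmetric])
    then show ?thesis
      unfolding nn[OF assms(2) S] by (simp add: ennreal_mult'[symmetric] mult.assoc[symmetric])
  qed
  finally show "(\<integral>\<^sup>+ y. ennreal (pe_ml \<kappa> n (append_sample m x y)) \<partial>?P) =
    ennreal (sqrt (real n / real m) * exp (- sqrt (2 * \<kappa> * real m * (\<Sum>i\<in>{1..m}. x i))))" .
qed

lemma AE_PiM_pe_base_nonneg:
  assumes "0 < \<kappa>" "finite I"
  shows "AE y in (\<Pi>\<^sub>M i\<in>I. pe_base \<kappa>). \<forall>i\<in>(I :: nat set). 0 \<le> y i"
proof (rule AE_finite_allI[OF assms(2)])
  interpret P: product_sigma_finite "\<lambda>_ :: nat. pe_base \<kappa>"
    using assms(1) by (rule product_sigma_finite_pe_base)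
  fix i assume i: "i \<in> I"
  let ?A = "\<lambda>j. if j = i then {..<0 :: real} else UNIV"
  show "AE y in (\<Pi>\<^sub>M i\<in>I. pe_base \<kappa>). 0 \<le> y i"
  proof (rule AE_I)
    have "{..<0::real} \<inter> {0<..} = {}" by auto
    then have "emeasure (pe_base \<kappa>) (?A i) = 0" by (simp add: emeasure_pe_base)
    then show "emeasure (\<Pi>\<^sub>M i\<in>I. pe_base \<kappa>) (Pi\<^sub>E I ?A) = 0"
      using i assms(2) by (subst P.emeasure_PiM) (auto intro!: prod_zero)
    show "Pi\<^sub>E I ?A \<in> sets (\<Pi>\<^sub>M i\<in>I. pe_base \<kappa>)"
      using assms(2) by (intro sets_PiM_I_finite) auto
    show "{y \<in> space (\<Pi>\<^sub>M i\<in>I. pe_base \<kappa>). \<not> 0 \<le> y i} \<subseteq> Pi\<^sub>E I ?A"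
      by (auto simp: space_PiM PiE_iff extensional_def not_le)
  qed
qed

text \<open>Completing the square, the exponent of the likelihood is a constant minus a multiple of
  \<open>(\<beta> - \<beta>\<^sub>0)\<^sup>2 / \<beta>\<close>, where \<open>\<beta>\<^sub>0\<close> is the maximum likelihood estimate.\<close>

lemma jeffreys_posterior:
  fixes x :: "nat \<Rightarrow> real"
  assumes "0 < \<kappa>" "0 < m" and S: "0 < (\<Sum>i\<in>{1..m}. x i)"
  shows "pe_posterior \<kappa> (jeffreys_prior \<kappa>) m x =
    inverse_gaussian (sqrt (real m * \<kappa> / (2 * (\<Sum>i\<in>{1..m}. x i)))) (real m * \<kappa>)"
proof -
  define S where "S = (\<Sum>i\<in>{1..m}. x i)"
  define b where "b = sqrt (real m * \<kappa> / (2 * S))"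
  define k where "k = real m * \<kappa>"
  have S': "0 < S" using S by (simp add: S_def)
  have k: "0 < k" using assms by (simp add: k_def)
  have b: "0 < b" "b\<^sup>2 = k / (2 * S)" using k S' by (simp_all add: b_def k_def)
  have kb: "k / b = sqrt (2 * \<kappa> * real m * S)"
  proof (rule real_sqrt_unique[symmetric])
    show "(k / b)\<^sup>2 = 2 * \<kappa> * real m * S"
      using S' k by (simp add: power_divide b(2)) (simp add: k_def power2_eq_square)
  qed (use b k in simp)
  have "pe_lik \<kappa> t m x * jeffreys_prior \<kappa> t / pe_marginal \<kappa> (jeffreys_prior \<kappa>) m x =
     sqrt (k / (2 * pi * t ^ 3)) * exp (- k * (t - b)\<^sup>2 / (2 * b\<^sup>2 * t))" if t: "0 < t" for t
  proof -
    have "- k * (t - b)\<^sup>2 / (2 * b\<^sup>2 * t) = - k / (2 * b\<^sup>2) * t + k / b - k / (2 * t)"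
      using b(1) t by (simp add: field_simps power2_eq_square)
    also have "- k / (2 * b\<^sup>2) = - S" using k S' by (simp add: b(2))
    finally have e: "exp (- k * (t - b)\<^sup>2 / (2 * b\<^sup>2 * t)) =
        exp (- t * S - k / (2 * t)) / exp (- (k / b))"
      unfolding exp_diff[symmetric] by (simp add: algebra_simps)
    have "sqrt \<kappa> / sqrt t ^ 3 / sqrt (2 * pi / real m) = sqrt (\<kappa> / t ^ 3 / (2 * pi / real m))"
      by (simp only: real_sqrt_divide real_sqrt_power)
    also have "\<kappa> / t ^ 3 / (2 * pi / real m) = k / (2 * pi * t ^ 3)"
      by (simp add: k_def field_simps)
    finally have c: "sqrt (k / (2 * pi * t ^ 3)) = sqrt \<kappa> / sqrt t ^ 3 / sqrt (2 * pi / real m)" ..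
    show ?thesis
      unfolding e c jeffreys_marginal(2)[OF assms(1,2) less_imp_le[OF S]] pe_lik_eq
        jeffreys_prior_eq[OF assms(1) t] S_def[symmetric] kb[symmetric] k_def[symmetric]
      by (simp add: mult_ac)
  qed
  then have "pe_posterior \<kappa> (jeffreys_prior \<kappa>) m x = inverse_gaussian b k"
    unfolding pe_posterior_def inverse_gaussian_def
    by (intro arg_cong[where f = "density lborel"] ext) (simp split: split_indicator)
  then show ?thesis unfolding b_def k_def S_def .
qed

lemma cnml_eq_bayes:
  assumes "0 < \<kappa>" "m \<le> n" and x: "\<forall>i\<in>{1..n}. 0 \<le> x i"
    and cnml: "cnml_defined \<kappa> m n x" and bayes: "bayes_defined \<kappa> (jeffreys_prior \<kappa>) m n x"
  shows "cnml \<kappa> m n x = bayes \<kappa> (jeffreys_prior \<kappa>) m n x"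
proof -
  \<comment> \<open>Jeffreys' prior cannot be normalized, so a Bayesian prediction needs at least one observation.\<close>
  have m: "0 < m"
    using bayes jeffreys_marginal_no_data[OF assms(1), of x]
    by (cases "m = 0") (auto simp: bayes_defined_def)
  have n: "0 < n" and Sn: "0 < (\<Sum>i\<in>{1..n}. x i)"
    using cnml ex1_pe_mle_iff[OF assms(1)] by (auto simp: cnml_defined_def)
  have Sm: "0 \<le> (\<Sum>i\<in>{1..m}. x i)" using x assms(2) by (intro sum_nonneg) auto
  have AE: "AE y in (\<Pi>\<^sub>M i\<in>{m+1..n}. pe_base \<kappa>). 0 < (\<Sum>i\<in>{1..n}. append_sample m x y i)"
    using cnml unfolding cnml_defined_def ex1_pe_mle_iff[OF assms(1)] by auto
  have "(\<integral> y. pe_ml \<kappa> n (append_sample m x y) \<partial>(\<Pi>\<^sub>M i\<in>{m+1..n}. pe_base \<kappa>)) =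
      sqrt (real n / real m) * exp (- sqrt (2 * \<kappa> * real m * (\<Sum>i\<in>{1..m}. x i)))"
    using cnml_normalizer[OF assms(1) m assms(2) Sm AE] by (rule has_bochner_integral_integral_eq)
  moreover have "sqrt (2 * pi / real n) / sqrt (2 * pi / real m) = 1 / sqrt (real n / real m)"
    using n m by (simp add: real_sqrt_divide)
  ultimately show ?thesis
    unfolding cnml_def bayes_def pe_ml_eq[OF assms(1) n Sn]
      jeffreys_marginal(2)[OF assms(1) n less_imp_le[OF Sn]] jeffreys_marginal(2)[OF assms(1) m Sm]
    using n m by (simp add: field_simps)
qed

lemma predictors_defined:
  assumes "0 < \<kappa>" "m \<le> n" and x: "\<forall>i\<in>{1..n}. 0 \<le> x i" and x0: "\<exists>i\<in>{1..m}. x i \<noteq> 0"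
  shows "cnml_defined \<kappa> m n x \<and> bayes_defined \<kappa> (jeffreys_prior \<kappa>) m n x"
proof -
  from x0 have m: "0 < m" by auto
  then have n: "0 < n" using assms(2) by simp
  have nn: "\<forall>i\<in>{1..m}. 0 \<le> x i" using x assms(2) by auto
  from x0 obtain j where j: "j \<in> {1..m}" "x j \<noteq> 0" by blast
  then have Sm: "0 < (\<Sum>i\<in>{1..m}. x i)" using nn by (intro sum_pos2[of _ j]) force+
  have Sn: "0 < (\<Sum>i\<in>{1..n}. x i)" using j x assms(2) by (intro sum_pos2[of _ j]) force+
  have AE: "AE y in (\<Pi>\<^sub>M i\<in>{m+1..n}. pe_base \<kappa>). 0 < (\<Sum>i\<in>{1..n}. append_sample m x y i)"
    using AE_PiM_pe_base_nonneg[OF assms(1) finite_atLeastAtMost, of "m + 1" n]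
  proof eventually_elim
    case (elim y)
    then show ?case
      unfolding sum_append_sample[OF assms(2)] using Sm
      by (intro add_pos_nonneg sum_nonneg) auto
  qed
  have "cnml_defined \<kappa> m n x"
    using cnml_normalizer[OF assms(1) m assms(2) less_imp_le[OF Sm] AE] AE Sn n m
    unfolding cnml_defined_def ex1_pe_mle_iff[OF assms(1)] by (auto simp: has_bochner_integral_iff)
  moreover have "bayes_defined \<kappa> (jeffreys_prior \<kappa>) m n x"
    using jeffreys_marginal[OF assms(1) n less_imp_le[OF Sn]]
      jeffreys_marginal[OF assms(1) m less_imp_le[OF Sm]] m
    by (simp add: bayes_defined_def)
  ultimately show ?thesis ..
qed

theorem mainTheorem5:
  fixes \<kappa> :: real
  assumes "\<kappa> > 0"
  shows
    "(\<forall>m n x. m \<le> n \<longrightarrow> (\<forall>i\<in>{1..n}. 0 \<le> x i) \<longrightarrow>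
        cnml_defined \<kappa> m n x \<longrightarrow> bayes_defined \<kappa> (jeffreys_prior \<kappa>) m n x \<longrightarrow>
        cnml \<kappa> m n x = bayes \<kappa> (jeffreys_prior \<kappa>) m n x) \<and>
     (\<forall>m n x. m \<le> n \<longrightarrow> (\<forall>i\<in>{1..n}. 0 \<le> x i) \<longrightarrow> (\<exists>i\<in>{1..m}. x i \<noteq> 0) \<longrightarrow>
        cnml_defined \<kappa> m n x \<and> bayes_defined \<kappa> (jeffreys_prior \<kappa>) m n x) \<and>
     (\<forall>m x. (\<forall>i\<in>{1..m}. 0 \<le> x i) \<longrightarrow> (\<exists>i\<in>{1..m}. x i \<noteq> 0) \<longrightarrow>
        (\<exists>\<beta>\<^sub>0 > 0. \<exists>k > 0. pe_posterior \<kappa> (jeffreys_prior \<kappa>) m x = inverse_gaussian \<beta>\<^sub>0 k))"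
proof (intro conjI allI impI)
  fix m and x :: "nat \<Rightarrow> real"
  assume nn: "\<forall>i\<in>{1..m}. 0 \<le> x i" and x0: "\<exists>i\<in>{1..m}. x i \<noteq> 0"
  from x0 obtain j where j: "j \<in> {1..m}" "x j \<noteq> 0" by blast
  then have S: "0 < (\<Sum>i\<in>{1..m}. x i)" using nn by (intro sum_pos2[of _ j]) force+
  have m: "0 < m" using j by simp
  show "\<exists>\<beta>\<^sub>0 > 0. \<exists>k > 0. pe_posterior \<kappa> (jeffreys_prior \<kappa>) m x = inverse_gaussian \<beta>\<^sub>0 k"
    using jeffreys_posterior[OF assms m S] assms m S
    by (intro exI[of _ "sqrt (real m * \<kappa> / (2 * (\<Sum>i\<in>{1..m}. x i)))"] exI[of _ "real m * \<kappa>"] conjI)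
       simp_all
qed (use assms cnml_eq_bayes predictors_defined in blast)+

end
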